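(* Let $K\subset\mathbb{R}$ be a compact set with $\lambda(K)>0$ and let $d\in\mathbb{N}^+$. Let $\varphi$ be a gauge function with $\lim_{r\to0+}\varphi(r)/r=\infty$. Then for the prevalent $f\in C(K,\mathbb{R}^d)$ there exists an open set $U_f\subset\mathbb{R}^d$ such that $\lambda(f^{-1}(U_f))=\lambda(K)$ and for all $y\in U_f$ we have $$\mathcal{H}^{\varphi}(f^{-1}(y))>0.$$
   Context: Prevalence: for an abelian Polish group $G$, a set $A\subset G$ is shy if there exist a Borel set $B\supset A$ in $G$ and a Borel probability measure $\nu$ on $G$ with $\nu(B+x)=0$ for all $x\in G$; complements of shy sets are prevalent. "For the prevalent $f\in G$ property $P$ holds" means that $\{f\in G: P(f)\}$ is prevalent. For compact metric $K$, $C(K,\mathbb{R}^d)$ is the Banach space of continuous maps $K\to\mathbb{R}^d$ with the maximum norm (an abelian Polish group under addition). $\lambda$ is one-dimensional Lebesgue measure. A gauge function is a non-decreasing function $\varphi:[0,\infty)\to[0,\infty)$ with $\varphi(0)=0$. The $\varphi$-Hausdorff measure of a metric space $X$ is $\mathcal{H}^\varphi(X)=\lim_{\delta\to0+}\mathcal{H}^\varphi_\delta(X)$, where $\mathcal{H}^\varphi_\delta(X)=\inf\{\sum_{i=1}^\infty\varphi(\operatorname{diam}A_i): X\subset\bigcup_{i=1}^\infty A_i,\ \operatorname{diam}A_i\leq\delta\text{ for all }i\}$, with $\operatorname{diam}\emptyset=0$. *)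

theory Defs
  imports "HOL-Probability.Probability" "HOL-Algebra.Coset"
begin

section \<open>Prevalence\<close>

definition borel_algebra :: "'a topology \<Rightarrow> 'a measure" where
  "borel_algebra T = sigma (topspace T) {U. openin T U}"

text \<open>
  An abelian Polish group is given by a group \<open>G\<close> together with a topology \<open>T\<close> on its carrier.
  The group is written multiplicatively, as in HOL-Algebra, so \<open>B #>\<^bsub>G\<^esub> x\<close> is the translate
  \<open>B + x\<close>. When \<open>G\<close> is a topological group, translations are homeomorphisms, hence the translates
  of a Borel set are Borel and \<open>emeasure\<close> is never evaluated outside \<open>sets \<nu>\<close>.
\<close>

definition shy :: "('a, 'b) monoid_scheme \<Rightarrow> 'a topology \<Rightarrow> 'a set \<Rightarrow> bool" where
  "shy G T A \<longleftrightarrow> A \<subseteq> carrier G \<and>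
     (\<exists>B \<in> sets (borel_algebra T). A \<subseteq> B \<and>
        (\<exists>\<nu>. prob_space \<nu> \<and> sets \<nu> = sets (borel_algebra T) \<and>
             (\<forall>x \<in> carrier G. emeasure \<nu> (B #>\<^bsub>G\<^esub> x) = 0)))"

definition prevalent :: "('a, 'b) monoid_scheme \<Rightarrow> 'a topology \<Rightarrow> 'a set \<Rightarrow> bool" where
  "prevalent G T A \<longleftrightarrow> A \<subseteq> carrier G \<and> shy G T (carrier G - A)"

section \<open>The group of continuous maps on a compact set\<close>

text \<open>
  \<open>C(K, E)\<close> with the maximum distance. A map on \<open>K\<close> is represented by its extensional
  extension (\<open>undefined\<close> outside \<open>K\<close>).
\<close>

abbreviation C_metric :: "'a::metric_space set \<Rightarrow> ('a \<Rightarrow> 'b::real_normed_vector) metric" where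
  "C_metric K \<equiv> cfunspace (top_of_set K) euclidean_metric"

definition C_group :: "'a::metric_space set \<Rightarrow> ('a \<Rightarrow> 'b::real_normed_vector) monoid" where
  "C_group K = \<lparr>carrier = mspace (C_metric K),
                mult = (\<lambda>f g. \<lambda>x\<in>K. f x + g x),
                one = (\<lambda>x\<in>K. 0)\<rparr>"

lemma carrier_C_group:
  assumes "compact K"
  shows "carrier (C_group K) = {f. continuous_on K f \<and> f \<in> extensional K}"
proof -
  have "Metric_space.mbounded UNIV dist (f ` K)"
    if "continuous_on K f" for f :: "'a \<Rightarrow> 'b"
    using compact_imp_bounded[OF compact_continuous_image[OF that assms]] by simp
  then show ?thesis
    by (auto simp: C_group_def)
qed

lemma mdist_C_metric:
  assumes "compact K" "K \<noteq> {}" "f \<in> carrier (C_group K)" "g \<in> carrier (C_group K)"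
  shows "mdist (C_metric K) f g = (SUP x\<in>K. norm (f x - g x))"
proof -
  have "f \<in> Metric_space.fspace UNIV dist K" "g \<in> Metric_space.fspace UNIV dist K"
    using assms
    by (auto simp: C_group_def Metric_space.fspace_def[OF Met_TC.Metric_space_axioms])
  then show ?thesis
    using assms(2)
    by (simp add: cfunspace_def Met_TC.fdist_def dist_norm)
qed

lemma comm_group_C_group:
  assumes "compact K"
  shows "comm_group (C_group K)"
proof (rule comm_groupI)
  show "\<exists>g\<in>carrier (C_group K). g \<otimes>\<^bsub>C_group K\<^esub> f = \<one>\<^bsub>C_group K\<^esub>"
    if "f \<in> carrier (C_group K)" for f :: "'a \<Rightarrow> 'b"
  proof
    show "(\<lambda>x\<in>K. - f x) \<in> carrier (C_group K)"
      using that by (auto simp: carrier_C_group[OF assms] cong: continuous_on_cong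
          intro!: continuous_intros)
  qed (auto simp: C_group_def restrict_def)
qed (use carrier_C_group[OF assms, where 'b='b] in
    \<open>auto simp: C_group_def extensional_def restrict_def fun_eq_iff algebra_simps
       cong: continuous_on_cong intro!: continuous_intros\<close>)

section \<open>Hausdorff measures with respect to a gauge function\<close>

definition gauge_function :: "(real \<Rightarrow> real) \<Rightarrow> bool" where
  "gauge_function \<phi> \<longleftrightarrow> mono_on {0..} \<phi> \<and> \<phi> 0 = 0"

text \<open>
  The metric space is a subset \<open>X\<close> of an ambient metric space, covered by subsets of itself.
  Boundedness is spelled out because \<open>diameter\<close> is unspecified for unbounded sets,
  which have infinite diameter.
\<close>

definition hausdorff_content :: "(real \<Rightarrow> real) \<Rightarrow> real \<Rightarrow> 'a::metric_space set \<Rightarrow> ennreal" where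
  "hausdorff_content \<phi> \<delta> X =
     (INF A \<in> {A :: nat \<Rightarrow> 'a set. (\<forall>i. A i \<subseteq> X \<and> bounded (A i) \<and> diameter (A i) \<le> \<delta>)
                 \<and> X \<subseteq> (\<Union>i. A i)}.
        \<Sum>i. ennreal (\<phi> (diameter (A i))))"

definition hausdorff_measure :: "(real \<Rightarrow> real) \<Rightarrow> 'a::metric_space set \<Rightarrow> ennreal" where
  "hausdorff_measure \<phi> X = Lim (at_right 0) (\<lambda>\<delta>. hausdorff_content \<phi> \<delta> X)"

lemma hausdorff_content_antimono:
  "\<delta> \<le> \<epsilon> \<Longrightarrow> hausdorff_content \<phi> \<epsilon> X \<le> hausdorff_content \<phi> \<delta> X"
  unfolding hausdorff_content_def by (rule INF_superset_mono) (auto intro: order_trans)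

text \<open>The limit defining the measure always exists.\<close>

lemma hausdorff_content_tendsto_SUP:
  "((\<lambda>\<delta>. hausdorff_content \<phi> \<delta> X) \<longlongrightarrow> (SUP \<delta>\<in>{0<..}. hausdorff_content \<phi> \<delta> X)) (at_right 0)"
proof (rule increasing_tendsto)
  show "\<forall>\<^sub>F \<delta> in at_right 0.
      hausdorff_content \<phi> \<delta> X \<le> (SUP \<delta>\<in>{0<..}. hausdorff_content \<phi> \<delta> X)"
    using eventually_at_right_less[of "0::real"]
    by eventually_elim (auto intro: SUP_upper)
next
  fix y assume "y < (SUP \<delta>\<in>{0<..}. hausdorff_content \<phi> \<delta> X)"
  then obtain \<epsilon> :: real where "\<epsilon> > 0" "y < hausdorff_content \<phi> \<epsilon> X"
    by (auto simp: less_SUP_iff)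
  then show "\<forall>\<^sub>F \<delta> in at_right 0. y < hausdorff_content \<phi> \<delta> X"
    by (auto simp: eventually_at_right[OF \<open>\<epsilon> > 0\<close>] intro!: exI[of _ \<epsilon>]
        intro: less_le_trans hausdorff_content_antimono less_imp_le)
qed

lemma hausdorff_measure_eq_SUP:
  "hausdorff_measure \<phi> X = (SUP \<delta>\<in>{0<..}. hausdorff_content \<phi> \<delta> X)"
  unfolding hausdorff_measure_def
  by (rule tendsto_Lim[OF _ hausdorff_content_tendsto_SUP]) simp

end

theory Submission
  imports Defs
begin

text \<open>
  The transverse measure is \<open>\<nu>\<close>, the law of \<open>\<Sum>m. g\<^sub>m\<close>, where \<open>g\<^sub>m\<close> has amplitude \<open>2\<^sup>-\<^sup>m\<close> and is
  built from independent vectors with a tent density, one for each interval of length \<open>r m\<close>.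
  For the occupation measure of \<open>h = f + \<Sum>m. g\<^sub>m\<close> on \<open>K\<close>, compare the convolutions with the tents of
  widths \<open>b m\<close> and \<open>b (m+1)\<close>. With all levels but \<open>m\<close> frozen, the law of \<open>g\<^sub>m(t)\<close> smooths both kernels to
  nearly the same function, and the fluctuations are those of a sum of about \<open>1 / r m\<close> essentially
  independent terms of size \<open>r m\<close>. So if \<open>r m\<close> is small enough in terms of \<open>b\<close> and \<open>r (m-1)\<close>, the two
  convolutions are almost surely eventually uniformly close, on \<open>K\<close> and on each of its pieces of length
  \<open>r n\<close>, \<open>n < m\<close>, whatever \<open>f\<close> is. Closeness at one scale is a closed condition on \<open>h\<close>, hence the
  exceptional set is Borel.

  For every non-exceptional \<open>h\<close> the occupation measure has a continuous density \<open>q\<close>, and the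
  restriction of the measure to an interval of length \<open>r n\<close> has density at most \<open>r n * D n\<close> with \<open>D n\<close>
  depending only on \<open>b\<close>. Take \<open>U = {q > 0}\<close>. As \<open>\<phi>(s) / s \<rightarrow> \<infinity>\<close>, the scales \<open>r n\<close> can be chosen so small that
  \<open>D (n+1) * s\<close> is dominated by \<open>\<phi>(s)\<close> for \<open>s \<le> r n\<close>, and the mass distribution principle applies
  to the fibres over \<open>U\<close>.
\<close>

section \<open>Tent kernels\<close>

text \<open>The \<open>itself\<close> argument fixes the space over which the cone is integrated,
  since the number \<open>b\<close> does not determine it.\<close>

definition tent_mass :: "'a::euclidean_space itself \<Rightarrow> real \<Rightarrow> real" where
  "tent_mass _ b = (\<integral>z. max 0 (b - norm (z::'a)) \<partial>lborel)"

text \<open>For \<open>b > 0\<close> this is a probability density that vanishes off the ball of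
  radius \<open>b\<close>. Unlike the normalised indicator of a ball it is Lipschitz, so quantities
  built from it can be controlled on finite nets.\<close>

definition tent :: "real \<Rightarrow> 'a::euclidean_space \<Rightarrow> real" where
  "tent b x = max 0 (b - norm x) / tent_mass TYPE('a) b"

lemma integrable_max_norm: "integrable lborel (\<lambda>z::'a::euclidean_space. max 0 (b - norm z))"
proof -
  have "integrable lborel (\<lambda>z::'a. indicator (cball 0 b) z *\<^sub>R max 0 (b - norm z))"
    by (rule borel_integrable_compact) (auto intro!: continuous_intros)
  moreover have "(\<lambda>z::'a. indicator (cball 0 b) z *\<^sub>R max 0 (b - norm z)) = (\<lambda>z. max 0 (b - norm z))"
    by (auto simp: fun_eq_iff indicator_def)
  ultimately show ?thesis by simp
qed

lemma tent_mass_mono: "b \<le> c \<Longrightarrow> tent_mass TYPE('a::euclidean_space) b \<le> tent_mass TYPE('a) c"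
  unfolding tent_mass_def by (intro integral_mono integrable_max_norm) auto

lemma tent_mass_pos:
  assumes "b > 0" shows "tent_mass TYPE('a::euclidean_space) b > 0"
proof -
  have "0 < (b/2) * measure lborel (ball (0::'a) (b/2))"
    using assms content_ball_pos[of "b/2" "0::'a"] by simp
  also have "\<dots> = (\<integral>z. (b/2) * indicator (ball (0::'a) (b/2)) z \<partial>lborel)"
    by simp
  also have "\<dots> \<le> tent_mass TYPE('a) b"
    unfolding tent_mass_def
    using assms emeasure_lborel_ball_finite[of "0::'a" "b/2"]
    by (intro integral_mono integrable_max_norm integrable_mult_right integrable_real_indicator)
      (auto simp: indicator_def)
  finally show ?thesis .
qed

lemma continuous_on_tent[continuous_intros]:
  "continuous_on A f \<Longrightarrow> continuous_on A (\<lambda>x. tent b (f x))"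
  unfolding tent_def divide_inverse by (intro continuous_intros)

lemma borel_measurable_tent[measurable]: "tent b \<in> borel_measurable borel"
  by (intro borel_measurable_continuous_onI continuous_intros)

lemma tent_nonneg: "b > 0 \<Longrightarrow> tent b (x::'a::euclidean_space) \<ge> 0"
  using tent_mass_pos[of b, where 'a='a] by (simp add: tent_def)

lemma tent_le: "b > 0 \<Longrightarrow> tent b (x::'a::euclidean_space) \<le> b / tent_mass TYPE('a) b"
  using tent_mass_pos[of b, where 'a='a] by (simp add: tent_def divide_right_mono)

lemma tent_eq_0: "norm x \<ge> b \<Longrightarrow> tent b x = 0"
  by (simp add: tent_def)

lemma tent_lipschitz:
  fixes x y :: "'a::euclidean_space"
  assumes "b > 0" shows "\<bar>tent b x - tent b y\<bar> \<le> norm (x - y) / tent_mass TYPE('a) b"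
proof -
  have "\<bar>max 0 (b - norm x) - max 0 (b - norm y)\<bar> \<le> norm (x - y)"
    using norm_triangle_ineq3[of x y] by (auto simp: max_def)
  then show ?thesis
    using tent_mass_pos[OF assms, where 'a='a]
    by (simp add: tent_def divide_right_mono flip: diff_divide_distrib)
qed

lemma tent_minus_commute: "tent b (x - y) = tent b (y - x)"
  by (simp add: tent_def norm_minus_commute)

lemma has_integral_tent:
  assumes "b > 0"
  shows "integrable lborel (\<lambda>x::'a::euclidean_space. tent b (x - z))"
    and "(\<integral>x. tent b (x - z) \<partial>lborel) = 1"
proof -
  have i: "integrable lborel (tent b :: 'a \<Rightarrow> real)"
    unfolding tent_def[abs_def] by (rule integrable_divide_zero) (rule integrable_max_norm)
  have e: "(\<integral>x. tent b (x::'a) \<partial>lborel) = 1"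
    using tent_mass_pos[OF assms, where 'a='a]
    by (simp add: tent_def[abs_def] tent_mass_def)
  have d: "(lborel :: 'a measure) = distr lborel borel ((+) (- z))"
    by (simp add: lborel_distr_plus)
  show "integrable lborel (\<lambda>x::'a. tent b (x - z))"
    using i by (subst (asm) d, subst (asm) integrable_distr_eq) auto
  show "(\<integral>x. tent b (x - z) \<partial>lborel) = 1"
    using e by (subst (asm) d, subst (asm) integral_distr) auto
qed

text \<open>The factor \<open>tent b (z - x)\<close> is a probability density in \<open>x\<close>
  that lives within distance \<open>b\<close> of \<open>z\<close>, where \<open>tent a\<close>
  differs from \<open>tent a z\<close> by at most \<open>b / tent_mass TYPE('a) a\<close>. Hence any
  two narrow kernels become nearly equal after smoothing with the same
  \<open>tent a\<close>.\<close>

lemma tent_smoothing: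
  fixes z :: "'a::euclidean_space"
  assumes "a > 0" "b > 0"
  shows "integrable lborel (\<lambda>x. tent b (z - x) * tent a x)"
    and "\<bar>(\<integral>x. tent b (z - x) * tent a x \<partial>lborel) - tent a z\<bar> \<le> b / tent_mass TYPE('a) a"
proof -
  have I: "integrable lborel (\<lambda>x. tent b (z - x))" "(\<integral>x. tent b (z - x) \<partial>lborel) = 1"
    using has_integral_tent[OF assms(2), of z] by (simp_all add: tent_minus_commute)
  show J: "integrable lborel (\<lambda>x. tent b (z - x) * tent a x)"
    by (rule Bochner_Integration.integrable_bound[where f="\<lambda>x. tent b (z - x) * (a / tent_mass TYPE('a) a)"])
      (use I assms tent_mass_pos[OF assms(1), where 'a='a] in
        \<open>auto simp: abs_mult tent_nonneg tent_le simp del: times_divide_eq_right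
          intro!: mult_left_mono\<close>)
  have "(\<integral>x. tent b (z - x) * tent a x \<partial>lborel) - tent a z
      = (\<integral>x. tent b (z - x) * tent a x - tent b (z - x) * tent a z \<partial>lborel)"
    using I J by simp
  also have "\<bar>\<dots>\<bar> \<le> (\<integral>x. tent b (z - x) * (b / tent_mass TYPE('a) a) \<partial>lborel)"
  proof -
    have "norm (\<integral>x. tent b (z - x) * tent a x - tent b (z - x) * tent a z \<partial>lborel)
       \<le> (\<integral>x. tent b (z - x) * (b / tent_mass TYPE('a) a) \<partial>lborel)"
    proof (rule Bochner_Integration.integral_norm_bound_integral)
      fix x :: 'a
      show "norm (tent b (z - x) * tent a x - tent b (z - x) * tent a z)
        \<le> tent b (z - x) * (b / tent_mass TYPE('a) a)"
      proof (cases "norm (z - x) \<ge> b")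
        case False
        have "norm (x - z) / tent_mass TYPE('a) a \<le> b / tent_mass TYPE('a) a"
          using False tent_mass_pos[OF assms(1), where 'a='a]
          by (simp add: divide_right_mono norm_minus_commute)
        then have "\<bar>tent a x - tent a z\<bar> \<le> b / tent_mass TYPE('a) a"
          using tent_lipschitz[OF assms(1), of x z] by linarith
        then show ?thesis
          using mult_left_mono[OF _ tent_nonneg[OF assms(2), of "z - x"]] assms(2)
          by (simp add: abs_mult tent_nonneg flip: right_diff_distrib times_divide_eq_right)
      qed (simp add: tent_eq_0)
    qed (use I J in auto)
    then show ?thesis by simp
  qed
  also have "\<dots> = b / tent_mass TYPE('a) a"
    using I by simp
  finally show "\<bar>(\<integral>x. tent b (z - x) * tent a x \<partial>lborel) - tent a z\<bar> \<le> b / tent_mass TYPE('a) a" .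
qed

section \<open>Smoothed occupation densities\<close>

text \<open>The convolution of the occupation measure, that is the image of Lebesgue measure on
  \<open>T\<close> under \<open>h\<close>, with the tent of width \<open>b\<close>. It serves as an
  approximate occupation density.\<close>

definition smoothed :: "real \<Rightarrow> real set \<Rightarrow> (real \<Rightarrow> 'a::euclidean_space) \<Rightarrow> 'a \<Rightarrow> real" where
  "smoothed b T h y = (LINT t:T|lborel. tent b (y - h t))"

lemma set_integrable_tent:
  fixes h :: "real \<Rightarrow> 'a::euclidean_space"
  assumes [measurable]: "h \<in> borel_measurable borel" "T \<in> sets borel"
    and "emeasure lborel T < \<infinity>" "b > 0"
  shows "set_integrable lborel T (\<lambda>t. tent b (y - h t))"
  unfolding set_integrable_def
proof (rule Bochner_Integration.integrable_bound)
  show "integrable lborel (\<lambda>t. indicator T t * (b / tent_mass TYPE('a) b))"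
    using assms by (intro integrable_mult_left integrable_real_indicator) auto
qed (use assms tent_mass_pos[OF assms(4), where 'a='a] in
  \<open>auto simp: indicator_def tent_nonneg tent_le\<close>)

lemma smoothed_nonneg: "b > 0 \<Longrightarrow> smoothed b T h y \<ge> 0"
  unfolding smoothed_def set_lebesgue_integral_def
  by (rule Bochner_Integration.integral_nonneg) (simp add: tent_nonneg)

lemma smoothed_le:
  fixes h :: "real \<Rightarrow> 'a::euclidean_space"
  assumes [measurable]: "h \<in> borel_measurable borel" "T \<in> sets borel"
    and "emeasure lborel T < \<infinity>" "b > 0"
  shows "smoothed b T h y \<le> measure lborel T * (b / tent_mass TYPE('a) b)"
proof -
  have "smoothed b T h y \<le> (LINT t:T|lborel. b / tent_mass TYPE('a) b)"
    unfolding smoothed_def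
    using assms by (intro set_integral_mono set_integrable_tent)
      (auto simp: set_integrable_def tent_le)
  then show ?thesis
    using assms by (simp add: set_lebesgue_integral_def)
qed

lemma smoothed_lipschitz:
  fixes h h' :: "real \<Rightarrow> 'a::euclidean_space"
  assumes [measurable]: "h \<in> borel_measurable borel" "h' \<in> borel_measurable borel" "T \<in> sets borel"
    and "emeasure lborel T < \<infinity>" "b > 0"
    and le: "\<And>t. t \<in> T \<Longrightarrow> norm ((y - h t) - (y' - h' t)) \<le> c"
  shows "\<bar>smoothed b T h y - smoothed b T h' y'\<bar> \<le> measure lborel T * (c / tent_mass TYPE('a) b)"
proof -
  have i: "set_integrable lborel T (\<lambda>t. tent b (y - h t))" "set_integrable lborel T (\<lambda>t. tent b (y' - h' t))"
    using assms by (auto intro!: set_integrable_tent)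
  have "\<bar>smoothed b T h y - smoothed b T h' y'\<bar> = \<bar>LINT t:T|lborel. tent b (y - h t) - tent b (y' - h' t)\<bar>"
    unfolding smoothed_def by (simp add: set_integral_diff i)
  also have "\<dots> \<le> (LINT t:T|lborel. \<bar>tent b (y - h t) - tent b (y' - h' t)\<bar>)"
    using set_integral_norm_bound[OF set_integral_diff(1)[OF i]] by simp
  also have "\<dots> \<le> (LINT t:T|lborel. c / tent_mass TYPE('a) b)"
  proof (rule set_integral_mono)
    show "set_integrable lborel T (\<lambda>t. \<bar>tent b (y - h t) - tent b (y' - h' t)\<bar>)"
      using set_integrable_norm[OF set_integral_diff(1)[OF i]] by simp
    show "set_integrable lborel T (\<lambda>t. c / tent_mass TYPE('a) b)"
      using assms by (auto simp: set_integrable_def)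
    show "\<bar>tent b (y - h t) - tent b (y' - h' t)\<bar> \<le> c / tent_mass TYPE('a) b" if "t \<in> T" for t
      using tent_lipschitz[OF assms(5), of "y - h t" "y' - h' t"] le[OF that]
        divide_right_mono[OF le[OF that], of "tent_mass TYPE('a) b"] tent_mass_pos[OF assms(5), where 'a='a]
      by linarith
  qed
  finally show ?thesis
    using assms by (simp add: set_lebesgue_integral_def)
qed

lemma nn_integral_smoothed:
  fixes h :: "real \<Rightarrow> 'a::euclidean_space"
  assumes [measurable]: "h \<in> borel_measurable borel" "T \<in> sets borel" "A \<in> sets borel"
    and "emeasure lborel T < \<infinity>" "b > 0"
  shows "(\<integral>\<^sup>+y\<in>A. ennreal (smoothed b T h y) \<partial>lborel)
       = (\<integral>\<^sup>+t\<in>T. (\<integral>\<^sup>+y\<in>A. ennreal (tent b (y - h t)) \<partial>lborel) \<partial>lborel)"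
proof -
  have e: "ennreal (smoothed b T h y) = (\<integral>\<^sup>+t\<in>T. ennreal (tent b (y - h t)) \<partial>lborel)" for y
    unfolding smoothed_def set_lebesgue_integral_def
    using set_integrable_tent[OF assms(1,2,4,5)] assms(5)
    by (subst nn_integral_eq_integral[symmetric])
      (auto simp: set_integrable_def tent_nonneg indicator_def intro!: nn_integral_cong)
  have "(\<integral>\<^sup>+y\<in>A. ennreal (smoothed b T h y) \<partial>lborel)
      = (\<integral>\<^sup>+y. (\<integral>\<^sup>+t. ennreal (tent b (y - h t)) * indicator T t * indicator A y \<partial>lborel) \<partial>lborel)"
    unfolding e by (intro nn_integral_cong, subst nn_integral_multc) auto
  also have "\<dots> = (\<integral>\<^sup>+t. (\<integral>\<^sup>+y. ennreal (tent b (y - h t)) * indicator T t * indicator A y \<partial>lborel) \<partial>lborel)"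
    by (rule lborel_pair.Fubini') measurable
  also have "\<dots> = (\<integral>\<^sup>+t\<in>T. (\<integral>\<^sup>+y\<in>A. ennreal (tent b (y - h t)) \<partial>lborel) \<partial>lborel)"
    by (intro nn_integral_cong, subst nn_integral_multc[symmetric])
      (auto intro!: nn_integral_cong simp: ac_simps)
  finally show ?thesis .
qed

lemma nn_integral_tent: "b > 0 \<Longrightarrow> (\<integral>\<^sup>+y. ennreal (tent b (y - z)) \<partial>lborel) = 1"
  using has_integral_tent[of b z] by (subst nn_integral_eq_integral) (auto simp: tent_nonneg)

text \<open>Each \<open>t\<close> with \<open>h t\<close> in \<open>A\<close> contributes a tent
  whose whole unit mass lies over \<open>A'\<close>. Tonelli's theorem turns the total into the
  integral of \<open>smoothed\<close> over \<open>A'\<close>.\<close>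

lemma occupation_le_smoothed:
  fixes h :: "real \<Rightarrow> 'a::euclidean_space"
  assumes [measurable]: "h \<in> borel_measurable borel" "T \<in> sets borel" "A \<in> sets borel" "A' \<in> sets borel"
    and "emeasure lborel T < \<infinity>" "b > 0" "\<And>x. x \<in> A \<Longrightarrow> ball x b \<subseteq> A'"
    and c: "\<And>y. y \<in> A' \<Longrightarrow> smoothed b T h y \<le> c"
  shows "emeasure lborel {t\<in>T. h t \<in> A} \<le> ennreal c * emeasure lborel A'"
proof -
  have "{t\<in>T. h t \<in> A} = T \<inter> (h -` A \<inter> space borel)" by auto
  also have "\<dots> \<in> sets borel" by measurable
  finally have [measurable]: "{t\<in>T. h t \<in> A} \<in> sets borel" .
  have "emeasure lborel {t\<in>T. h t \<in> A} = (\<integral>\<^sup>+t. indicator {t\<in>T. h t \<in> A} t \<partial>lborel)"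
    by (rule nn_integral_indicator[symmetric]) simp
  also have "\<dots> \<le> (\<integral>\<^sup>+t\<in>T. (\<integral>\<^sup>+y\<in>A'. ennreal (tent b (y - h t)) \<partial>lborel) \<partial>lborel)"
  proof (intro nn_integral_mono)
    fix t
    have "(\<integral>\<^sup>+y\<in>A'. ennreal (tent b (y - h t)) \<partial>lborel) = 1" if "h t \<in> A"
    proof -
      have "(\<integral>\<^sup>+y\<in>A'. ennreal (tent b (y - h t)) \<partial>lborel) = (\<integral>\<^sup>+y. ennreal (tent b (y - h t)) \<partial>lborel)"
      proof (intro nn_integral_cong)
        fix y
        have "tent b (y - h t) = 0" if "y \<notin> A'"
          using that assms(7)[OF \<open>h t \<in> A\<close>]
          by (intro tent_eq_0) (auto simp: subset_iff dist_norm norm_minus_commute not_less)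
        then show "ennreal (tent b (y - h t)) * indicator A' y = ennreal (tent b (y - h t))"
          by (auto simp: indicator_def)
      qed
      then show ?thesis by (simp add: nn_integral_tent assms(6))
    qed
    then show "indicator {t \<in> T. h t \<in> A} t
        \<le> (\<integral>\<^sup>+y\<in>A'. ennreal (tent b (y - h t)) \<partial>lborel) * indicator T t"
      by (auto simp: indicator_def)
  qed
  also have "\<dots> = (\<integral>\<^sup>+y\<in>A'. ennreal (smoothed b T h y) \<partial>lborel)"
    by (rule nn_integral_smoothed[symmetric]) (use assms in auto)
  also have "\<dots> \<le> (\<integral>\<^sup>+y\<in>A'. ennreal c \<partial>lborel)"
    by (intro nn_integral_mono) (auto simp: indicator_def c ennreal_leI)
  also have "\<dots> = ennreal c * emeasure lborel A'"
    by (simp add: nn_integral_cmult_indicator)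
  finally show ?thesis .
qed

text \<open>The opposite comparison: a tent centred at \<open>h t\<close> reaches \<open>A\<close>
  only if \<open>h t\<close> lies in \<open>A'\<close>, and its mass over \<open>A\<close> is at
  most 1.\<close>

lemma smoothed_le_occupation:
  fixes h :: "real \<Rightarrow> 'a::euclidean_space"
  assumes [measurable]: "h \<in> borel_measurable borel" "T \<in> sets borel" "A \<in> sets borel" "A' \<in> sets borel"
    and "emeasure lborel T < \<infinity>" "b > 0" "\<And>x. x \<in> A \<Longrightarrow> ball x b \<subseteq> A'"
    and c: "\<And>y. y \<in> A \<Longrightarrow> c \<le> smoothed b T h y"
  shows "ennreal c * emeasure lborel A \<le> emeasure lborel {t\<in>T. h t \<in> A'}"
proof -
  have "{t\<in>T. h t \<in> A'} = T \<inter> (h -` A' \<inter> space borel)" by auto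
  also have "\<dots> \<in> sets borel" by measurable
  finally have [measurable]: "{t\<in>T. h t \<in> A'} \<in> sets borel" .
  have "ennreal c * emeasure lborel A = (\<integral>\<^sup>+y\<in>A. ennreal c \<partial>lborel)"
    by (simp add: nn_integral_cmult_indicator)
  also have "\<dots> \<le> (\<integral>\<^sup>+y\<in>A. ennreal (smoothed b T h y) \<partial>lborel)"
    by (intro nn_integral_mono) (auto simp: indicator_def c ennreal_leI)
  also have "\<dots> = (\<integral>\<^sup>+t\<in>T. (\<integral>\<^sup>+y\<in>A. ennreal (tent b (y - h t)) \<partial>lborel) \<partial>lborel)"
    by (rule nn_integral_smoothed) (use assms in auto)
  also have "\<dots> \<le> (\<integral>\<^sup>+t. indicator {t\<in>T. h t \<in> A'} t \<partial>lborel)"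
  proof (intro nn_integral_mono)
    fix t
    have le: "(\<integral>\<^sup>+y\<in>A. ennreal (tent b (y - h t)) \<partial>lborel) \<le> 1"
    proof -
      have "(\<integral>\<^sup>+y\<in>A. ennreal (tent b (y - h t)) \<partial>lborel) \<le> (\<integral>\<^sup>+y. ennreal (tent b (y - h t)) \<partial>lborel)"
        by (intro nn_integral_mono) (auto simp: indicator_def)
      then show ?thesis by (simp add: nn_integral_tent assms(6))
    qed
    have z: "(\<integral>\<^sup>+y\<in>A. ennreal (tent b (y - h t)) \<partial>lborel) = 0" if "h t \<notin> A'"
    proof -
      have "(\<integral>\<^sup>+y\<in>A. ennreal (tent b (y - h t)) \<partial>lborel) = (\<integral>\<^sup>+(y::'a). 0 \<partial>lborel)"
      proof (intro nn_integral_cong)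
        fix y
        have "tent b (y - h t) = 0" if "y \<in> A"
          using assms(7)[OF that] \<open>h t \<notin> A'\<close>
          by (intro tent_eq_0) (auto simp: subset_iff dist_norm not_less)
        then show "ennreal (tent b (y - h t)) * indicator A y = 0"
          by (auto simp: indicator_def)
      qed
      then show ?thesis by simp
    qed
    show "(\<integral>\<^sup>+y\<in>A. ennreal (tent b (y - h t)) \<partial>lborel) * indicator T t
        \<le> indicator {t \<in> T. h t \<in> A'} t"
      using le z by (auto simp: indicator_def)
  qed
  also have "\<dots> = emeasure lborel {t\<in>T. h t \<in> A'}"
    by (rule nn_integral_indicator) simp
  finally show ?thesis .
qed

section \<open>Fibres of functions with regular occupation densities\<close>

text \<open>Defined by the floor, so that disjointness and covering of the line are
  immediate.\<close>

definition cell :: "real \<Rightarrow> int \<Rightarrow> real set" where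
  "cell r j = {t. \<lfloor>t / r\<rfloor> = j}"

lemma cell_eq: "r > 0 \<Longrightarrow> cell r j = {of_int j * r..<(of_int j + 1) * r}"
  by (auto simp: cell_def floor_eq_iff field_simps)

lemma sets_cell[measurable]: "cell r j \<in> sets borel"
proof -
  have "cell r j = {t \<in> space borel. \<lfloor>t / r\<rfloor> = j}" by (simp add: cell_def)
  also have "\<dots> \<in> sets borel" by measurable
  finally show ?thesis .
qed

lemma emeasure_Int_cell_le:
  assumes "r > 0" "A \<in> sets borel"
  shows "emeasure lborel (A \<inter> cell r j) \<le> ennreal r"
proof -
  have "emeasure lborel (A \<inter> cell r j) \<le> emeasure lborel (cell r j)"
    by (rule emeasure_mono) auto
  then show ?thesis using assms(1) by (simp add: cell_eq algebra_simps)
qed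

text \<open>An interval of length \<open>l\<close> meets at most \<open>l / r + 2\<close> cells of
  length \<open>r\<close>, which is at most \<open>3 * l / r\<close> because
  \<open>r \<le> l\<close>.\<close>

lemma emeasure_interval_le_cells:
  fixes c :: ennreal
  assumes "0 < r" "r \<le> l" and [measurable]: "A \<in> sets borel"
    and c: "\<And>j. emeasure lborel (A \<inter> cell r j) \<le> ennreal r * c"
  shows "emeasure lborel (A \<inter> {a<..<a+l}) \<le> ennreal (3 * l) * c"
proof -
  let ?J = "{\<lfloor>a / r\<rfloor>..\<lfloor>(a + l) / r\<rfloor>}"
  have "A \<inter> {a<..<a+l} \<subseteq> (\<Union>j\<in>?J. A \<inter> cell r j)"
    using assms(1) by (auto simp: cell_def intro!: floor_mono divide_right_mono)
  then have "emeasure lborel (A \<inter> {a<..<a+l}) \<le> emeasure lborel (\<Union>j\<in>?J. A \<inter> cell r j)"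
    by (rule emeasure_mono) auto
  also have "\<dots> \<le> (\<Sum>j\<in>?J. emeasure lborel (A \<inter> cell r j))"
    by (rule emeasure_subadditive_finite) auto
  also have "\<dots> \<le> (\<Sum>j\<in>?J. ennreal r * c)"
    by (intro sum_mono c)
  also have "\<dots> = ennreal (real (card ?J) * r) * c"
    using assms(1) by (simp add: ennreal_mult ennreal_of_nat_eq_real_of_nat mult.assoc)
  also have "\<dots> \<le> ennreal (3 * l) * c"
  proof (intro mult_right_mono ennreal_leI)
    have "a / r \<le> (a + l) / r" using assms by (simp add: divide_right_mono)
    then have "\<lfloor>a / r\<rfloor> \<le> \<lfloor>(a + l) / r\<rfloor>" by (rule floor_mono)
    then have "real (card ?J) = of_int \<lfloor>(a + l) / r\<rfloor> - of_int \<lfloor>a / r\<rfloor> + 1"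
      by simp
    also have "\<dots> \<le> (a + l) / r - a / r + 2"
      by linarith
    also have "\<dots> = l / r + 2" by (simp add: add_divide_distrib)
    also have "\<dots> \<le> 3 * l / r" using assms by (simp add: field_simps)
    finally show "real (card ?J) * r \<le> 3 * l" using assms(1) by (simp add: field_simps)
  qed simp
  finally show ?thesis .
qed

lemma bounded_subset_interval:
  fixes A :: "real set"
  assumes "bounded A" "diameter A < l"
  shows "\<exists>a. A \<subseteq> {a<..<a+l}"
proof (cases "A = {}")
  case False
  \<comment> \<open>The surplus \<open>l - diameter A\<close> is split between the two ends, since
    the interval is open and \<open>A\<close> may contain its infimum and supremum.\<close>
  define a where "a = Inf A - (l - diameter A) / 2"
  have "a < x \<and> x < a + l" if "x \<in> A" for x
  proof
    have "Inf A \<le> x" using that assms(1) by (simp add: bounded_imp_bdd_below cInf_lower)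
    then show "a < x" using assms(2) by (simp add: a_def field_simps)
    have "x - diameter A \<le> z" if "z \<in> A" for z
      using diameter_bounded_bound[OF assms(1) \<open>x \<in> A\<close> that] by (simp add: dist_real_def)
    then have "x - diameter A \<le> Inf A" using False by (intro cInf_greatest) auto
    then show "x < a + l" using assms(2) by (simp add: a_def field_simps)
  qed
  then have "A \<subseteq> {a<..<a+l}" by auto
  then show ?thesis ..
qed auto

text \<open>
  The mass distribution principle, in a form that needs no measure on the fibre: compactness turns a
  cover of the fibre into a cover of a preimage of a small ball.
\<close>

lemma hausdorff_measure_fiber_pos:
  fixes h :: "real \<Rightarrow> 'a::euclidean_space"
  assumes K: "compact K" "continuous_on K h" and [measurable]: "h \<in> borel_measurable borel"
    and \<phi>: "gauge_function \<phi>"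
    and lower: "c > 0" "\<delta> > 0"
      "\<And>\<epsilon>. 0 < \<epsilon> \<Longrightarrow> \<epsilon> < \<delta> \<Longrightarrow> ennreal c * emeasure lborel (ball y \<epsilon>) \<le> emeasure lborel {t\<in>K. h t \<in> ball y \<epsilon>}"
    and upper: "\<delta>' > 0"
      "\<And>s \<eta>. 0 \<le> s \<Longrightarrow> s \<le> \<delta>' \<Longrightarrow> 0 < \<eta> \<Longrightarrow> \<exists>l>s. \<forall>a \<epsilon>. 0 < \<epsilon> \<longrightarrow>
         emeasure lborel ({t\<in>K. h t \<in> ball y \<epsilon>} \<inter> {a<..<a+l}) \<le> ennreal (\<phi> s + \<eta>) * emeasure lborel (ball y \<epsilon>)"
  shows "hausdorff_measure \<phi> (h -` {y} \<inter> K) > 0"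
proof -
  have \<phi>_nonneg: "\<phi> s \<ge> 0" if "s \<ge> 0" for s
    using \<phi> that by (metis atLeast_iff gauge_function_def mono_onD order_refl)
  have [measurable]: "K \<in> sets borel" using K(1) by (simp add: borel_compact)
  have [measurable]: "{t\<in>K. h t \<in> ball y \<epsilon>} \<in> sets borel" for \<epsilon>
  proof -
    have "{t\<in>K. h t \<in> ball y \<epsilon>} = K \<inter> (h -` ball y \<epsilon> \<inter> space borel)" by auto
    also have "\<dots> \<in> sets borel" by measurable
    finally show ?thesis .
  qed
  \<comment> \<open>The measure is the supremum of the contents, so a lower bound at the single
    scale \<open>\<delta>'\<close> is enough.\<close>
  have "ennreal c \<le> hausdorff_content \<phi> \<delta>' (h -` {y} \<inter> K)"
    unfolding hausdorff_content_def
  proof (intro INF_greatest, elim CollectE conjE)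
    fix A :: "nat \<Rightarrow> real set"
    assume A: "\<forall>i. A i \<subseteq> h -` {y} \<inter> K \<and> bounded (A i) \<and> diameter (A i) \<le> \<delta>'"
      and cov: "h -` {y} \<inter> K \<subseteq> (\<Union>i. A i)"
    show "ennreal c \<le> (\<Sum>i. ennreal (\<phi> (diameter (A i))))"
    proof (rule ennreal_le_epsilon)
      fix \<eta> :: real assume \<eta>: "\<eta> > 0"
      \<comment> \<open>Each covering set is replaced by a longer open interval; the extra costs
        \<open>\<eta> * (1/2)^Suc i\<close> sum to \<open>\<eta>\<close>.\<close>
      have "\<forall>i. \<exists>l a. A i \<subseteq> {a<..<a+l} \<and> (\<forall>\<epsilon>>0. emeasure lborel ({t\<in>K. h t \<in> ball y \<epsilon>} \<inter> {a<..<a+l})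
            \<le> ennreal (\<phi> (diameter (A i)) + \<eta> * (1/2)^Suc i) * emeasure lborel (ball y \<epsilon>))"
      proof
        fix i
        obtain l where l: "l > diameter (A i)" "\<forall>a \<epsilon>. 0 < \<epsilon> \<longrightarrow>
            emeasure lborel ({t\<in>K. h t \<in> ball y \<epsilon>} \<inter> {a<..<a+l})
            \<le> ennreal (\<phi> (diameter (A i)) + \<eta> * (1/2)^Suc i) * emeasure lborel (ball y \<epsilon>)"
          using upper(2)[of "diameter (A i)" "\<eta> * (1/2)^Suc i"] A \<eta> by (auto simp: diameter_ge_0)
        moreover obtain a where "A i \<subseteq> {a<..<a+l}"
          using bounded_subset_interval[of "A i" l] A l(1) by blast
        ultimately show "\<exists>l a. A i \<subseteq> {a<..<a+l} \<and> (\<forall>\<epsilon>>0. emeasure lborel ({t\<in>K. h t \<in> ball y \<epsilon>} \<inter> {a<..<a+l})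
            \<le> ennreal (\<phi> (diameter (A i)) + \<eta> * (1/2)^Suc i) * emeasure lborel (ball y \<epsilon>))"
          by blast
      qed
      from choice[OF this] obtain l where l: "\<forall>i. \<exists>a. A i \<subseteq> {a<..<a+l i} \<and> (\<forall>\<epsilon>>0. emeasure lborel ({t\<in>K. h t \<in> ball y \<epsilon>} \<inter> {a<..<a+l i})
            \<le> ennreal (\<phi> (diameter (A i)) + \<eta> * (1/2)^Suc i) * emeasure lborel (ball y \<epsilon>))" ..
      from choice[OF l] obtain a where la: "\<And>i. A i \<subseteq> {a i<..<a i + l i}"
        "\<And>i \<epsilon>. \<epsilon> > 0 \<Longrightarrow> emeasure lborel ({t\<in>K. h t \<in> ball y \<epsilon>} \<inter> {a i<..<a i + l i})
            \<le> ennreal (\<phi> (diameter (A i)) + \<eta> * (1/2)^Suc i) * emeasure lborel (ball y \<epsilon>)"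
        by blast
      \<comment> \<open>The part of \<open>K\<close> missed by the intervals is compact and its
        image avoids \<open>y\<close>, hence stays at distance at least \<open>d\<close> from
        \<open>y\<close>. The intervals therefore cover the whole preimage of
        \<open>ball y \<epsilon>\<close>, not only the fibre.\<close>
      define K' where "K' = K - (\<Union>i. {a i<..<a i + l i})"
      have "compact K'" unfolding K'_def using K(1) by (intro compact_diff open_UN) auto
      then have "closed (h ` K')"
        using K(2) by (intro compact_imp_closed compact_continuous_image)
          (auto simp: K'_def intro: continuous_on_subset)
      moreover have "y \<notin> h ` K'"
      proof
        assume "y \<in> h ` K'"
        then obtain t where t: "t \<in> K" "h t = y" "t \<notin> (\<Union>i. {a i<..<a i + l i})"
          by (auto simp: K'_def)
        then obtain i where "t \<in> A i" using cov by auto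
        then show False using la(1)[of i] t(3) by blast
      qed
      ultimately obtain d where d: "d > 0" "\<And>x. x \<in> h ` K' \<Longrightarrow> d \<le> dist y x"
        using separate_point_closed by metis
      define \<epsilon> where "\<epsilon> = min d (\<delta> / 2)"
      have \<epsilon>: "\<epsilon> > 0" "\<epsilon> < \<delta>" "\<epsilon> \<le> d" using d lower(2) by (auto simp: \<epsilon>_def)
      have sub: "{t\<in>K. h t \<in> ball y \<epsilon>} \<subseteq> (\<Union>i. {t\<in>K. h t \<in> ball y \<epsilon>} \<inter> {a i<..<a i + l i})"
      proof
        fix t assume t: "t \<in> {t\<in>K. h t \<in> ball y \<epsilon>}"
        then have "t \<notin> K'" using d(2)[of "h t"] \<epsilon>(3) by auto
        then show "t \<in> (\<Union>i. {t\<in>K. h t \<in> ball y \<epsilon>} \<inter> {a i<..<a i + l i})"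
          using t by (auto simp: K'_def)
      qed
      have "ennreal c * emeasure lborel (ball y \<epsilon>) \<le> emeasure lborel {t\<in>K. h t \<in> ball y \<epsilon>}"
        using lower \<epsilon> by simp
      also have "\<dots> \<le> emeasure lborel (\<Union>i. {t\<in>K. h t \<in> ball y \<epsilon>} \<inter> {a i<..<a i + l i})"
        by (rule emeasure_mono[OF sub]) measurable
      also have "\<dots> \<le> (\<Sum>i. emeasure lborel ({t\<in>K. h t \<in> ball y \<epsilon>} \<inter> {a i<..<a i + l i}))"
        by (rule emeasure_subadditive_countably) auto
      also have "\<dots> \<le> (\<Sum>i. ennreal (\<phi> (diameter (A i)) + \<eta> * (1/2)^Suc i) * emeasure lborel (ball y \<epsilon>))"
        by (intro suminf_le la(2) \<epsilon>) auto
      also have "\<dots> = (\<Sum>i. ennreal (\<phi> (diameter (A i)) + \<eta> * (1/2)^Suc i)) * emeasure lborel (ball y \<epsilon>)"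
        by (rule ennreal_suminf_multc)
      finally have "ennreal c * emeasure lborel (ball y \<epsilon>)
        \<le> (\<Sum>i. ennreal (\<phi> (diameter (A i)) + \<eta> * (1/2)^Suc i)) * emeasure lborel (ball y \<epsilon>)" .
      moreover have "emeasure lborel (ball y \<epsilon>) \<noteq> 0" "emeasure lborel (ball y \<epsilon>) \<noteq> \<top>"
        using \<epsilon>(1) emeasure_lborel_ball_finite[of y \<epsilon>] content_ball_pos[of \<epsilon> y]
        by (auto simp: measure_def)
      ultimately have "ennreal c \<le> (\<Sum>i. ennreal (\<phi> (diameter (A i)) + \<eta> * (1/2)^Suc i))"
        by (simp add: ennreal_mult_le_mult_iff mult.commute[of _ "emeasure lborel (ball y \<epsilon>)"])
      also have "\<dots> = (\<Sum>i. ennreal (\<phi> (diameter (A i))) + ennreal (\<eta> * (1/2)^Suc i))"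
        using A \<eta> by (intro suminf_cong ennreal_plus \<phi>_nonneg) (auto simp: diameter_ge_0)
      also have "\<dots> = (\<Sum>i. ennreal (\<phi> (diameter (A i)))) + (\<Sum>i. ennreal (\<eta> * (1/2)^Suc i))"
        by (rule suminf_add[symmetric]) auto
      also have "(\<Sum>i. ennreal (\<eta> * (1/2)^Suc i)) = ennreal \<eta>"
        using \<eta> sums_mult[OF power_half_series, of \<eta>] by (intro suminf_ennreal_eq) auto
      finally show "ennreal c \<le> (\<Sum>i. ennreal (\<phi> (diameter (A i)))) + ennreal \<eta>" .
    qed
  qed
  also have "\<dots> \<le> hausdorff_measure \<phi> (h -` {y} \<inter> K)"
    unfolding hausdorff_measure_eq_SUP using upper(1) by (intro SUP_upper) auto
  finally show ?thesis using lower(1) by (simp add: less_le_trans[of 0 "ennreal c"])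
qed


section \<open>Limit densities and their regularity\<close>

text \<open>The bracket is the geometric sum of \<open>1 / 2 ^ k\<close> over
  \<open>n \<le> k < M\<close>; keeping the subtracted term lets the induction close.\<close>

lemma telescope_bound:
  fixes s :: "nat \<Rightarrow> real"
  assumes "\<And>m. m \<ge> n \<Longrightarrow> \<bar>s m - s (Suc m)\<bar> \<le> c / 2 ^ m" "n \<le> M"
  shows "\<bar>s n - s M\<bar> \<le> c * (2 / 2 ^ n - 2 / 2 ^ M)"
  using assms(2)
proof (induction M rule: dec_induct)
  case (step m)
  have "\<bar>s n - s (Suc m)\<bar> \<le> c * (2 / 2 ^ n - 2 / 2 ^ m) + c / 2 ^ m"
    using step.IH assms(1)[OF step.hyps(1)] by linarith
  also have "\<dots> = c * (2 / 2 ^ n - 2 / 2 ^ Suc m)"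
    by (simp add: field_simps)
  finally show ?case .
qed simp

lemma uniform_limit_of_summable_steps:
  fixes s :: "nat \<Rightarrow> 'b \<Rightarrow> real"
  assumes "\<And>m y. m \<ge> m0 \<Longrightarrow> \<bar>s m y - s (Suc m) y\<bar> \<le> c / 2 ^ m"
  shows "\<exists>q. \<forall>e>0. \<exists>N. \<forall>n\<ge>N. \<forall>y. \<bar>s n y - q y\<bar> < e"
proof -
  have "0 \<le> c / 2 ^ m0" using assms[OF order_refl] abs_ge_zero order_trans by blast
  then have c: "c \<ge> 0" by (simp add: field_simps)
  have lim: "(\<lambda>n. c * (2 / 2 ^ n)) \<longlonglongrightarrow> 0"
    using tendsto_mult[OF tendsto_const[of c] LIMSEQ_divide_realpow_zero[of 2 2]] by simp
  have "\<forall>e>0. \<exists>N. \<forall>m n x. N \<le> m \<and> N \<le> n \<and> True \<longrightarrow> dist (s m x) (s n x) < e"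
  proof (intro allI impI)
    fix e :: real assume "e > 0"
    then obtain N where N: "c * (2 / 2 ^ n) < e" if "n \<ge> N" for n
      using order_tendstoD(2)[OF lim, of e] by (auto simp: eventually_sequentially)
    have le: "\<bar>s n x - s m x\<bar> < e" if "max N m0 \<le> n" "n \<le> m" for m n x
    proof -
      have "\<bar>s n x - s m x\<bar> \<le> c * (2 / 2 ^ n - 2 / 2 ^ m)"
        using that by (intro telescope_bound assms) auto
      also have "\<dots> \<le> c * (2 / 2 ^ n)" using c by (intro mult_left_mono) auto
      also have "\<dots> < e" using N that by simp
      finally show ?thesis .
    qed
    show "\<exists>N. \<forall>m n x. N \<le> m \<and> N \<le> n \<and> True \<longrightarrow> dist (s m x) (s n x) < e"
      using le by (intro exI[of _ "max N m0"]) (metis dist_commute dist_real_def nat_le_linear)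
  qed
  then obtain q where q: "\<forall>e>0. \<exists>N. \<forall>n x. N \<le> n \<and> True \<longrightarrow> dist (s n x) (q x) < e"
    using uniformly_convergent_eq_cauchy[of "\<lambda>_. True" s] by blast
  then show ?thesis by (auto simp: dist_real_def intro!: exI[of _ q])
qed

lemma emeasure_ball_double:
  "\<epsilon> \<ge> 0 \<Longrightarrow> emeasure lborel (ball (y::'a::euclidean_space) (2 * \<epsilon>)) = 2 ^ DIM('a) * emeasure lborel (ball y \<epsilon>)"
  by (simp add: emeasure_ball power_mult_distrib ennreal_mult' mult_ac flip: ennreal_power)

text \<open>The points of the image with \<open>q \<le> 0\<close> form a compact set
  \<open>F\<close>. It has a neighbourhood inside a fixed ball on which the smoothed densities
  eventually fall below an arbitrarily small \<open>2 * \<eta>\<close>, so the occupation measure of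
  \<open>F\<close> is zero.\<close>

lemma occupation_density_full:
  fixes h :: "real \<Rightarrow> 'a::euclidean_space"
  assumes K: "compact K" "continuous_on K h" and [measurable]: "h \<in> borel_measurable borel"
    and b: "\<And>n. b n > 0" "b \<longlonglongrightarrow> 0"
    and q: "continuous_on UNIV q" "\<And>e. e > 0 \<Longrightarrow> \<exists>N. \<forall>n\<ge>N. \<forall>y. \<bar>smoothed (b n) K h y - q y\<bar> < e"
  shows "emeasure lebesgue (h -` {y. q y > 0} \<inter> K) = emeasure lebesgue K"
proof -
  have [measurable]: "K \<in> sets borel" using K(1) by (simp add: borel_compact)
  have fin: "emeasure lborel K < \<infinity>" using K(1) by (rule emeasure_compact_finite)
  define F where "F = h ` K \<inter> {y. q y \<le> 0}"
  have hK: "compact (h ` K)" using K by (intro compact_continuous_image)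
  have F: "compact F" unfolding F_def
    using q(1) by (intro compact_Int_closed hK closed_Collect_le) auto
  obtain R where R: "h ` K \<subseteq> ball 0 R" using compact_imp_bounded[OF hK] by (auto dest: bounded_subset_ballD[of _ 0])
  have [measurable]: "F \<in> sets borel" using F by (simp add: borel_compact)
  define N where "N = {t\<in>K. h t \<in> F}"
  have N_eq: "N = K \<inter> (h -` F \<inter> space borel)" by (auto simp: N_def)
  have [measurable]: "N \<in> sets borel" unfolding N_eq by measurable
  have "emeasure lborel N \<le> 0 + ennreal e" if "e > 0" for e
  proof -
    define V where "V = measure lborel (ball (0::'a) R)"
    \<comment> \<open>Chosen so that \<open>2 * \<eta> * V \<le> e\<close>; the added 1 keeps the
      denominator positive.\<close>
    define \<eta> where "\<eta> = e / (2 * (V + 1))"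
    have V: "V \<ge> 0" by (simp add: V_def)
    have \<eta>: "\<eta> > 0" using that V by (simp add: \<eta>_def)
    define A where "A = ball 0 R \<inter> {y. q y < \<eta>}"
    have A: "open A" unfolding A_def using q(1) by (intro open_Int open_Collect_less) auto
    then have [measurable]: "A \<in> sets borel" by simp
    have "F \<subseteq> A" using R \<eta> by (auto simp: F_def A_def)
    then obtain d where d: "d > 0" "(\<Union>x\<in>F. ball x d) \<subseteq> A"
      using compact_subset_open_imp_ball_epsilon_subset[OF F A] by blast
    obtain n1 where n1: "\<And>n y. n \<ge> n1 \<Longrightarrow> \<bar>smoothed (b n) K h y - q y\<bar> < \<eta>" using q(2)[OF \<eta>] by blast
    obtain n2 where n2: "\<And>n. n \<ge> n2 \<Longrightarrow> b n < d"
      using order_tendstoD(2)[OF b(2) d(1)] by (auto simp: eventually_sequentially)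
    define n where "n = max n1 n2"
    have "emeasure lborel N \<le> ennreal (2 * \<eta>) * emeasure lborel A" unfolding N_def
    proof (rule occupation_le_smoothed[where b = "b n"])
      show "ball x (b n) \<subseteq> A" if "x \<in> F" for x
        using d(2) that n2[of n] by (force simp: n_def)
      show "smoothed (b n) K h y \<le> 2 * \<eta>" if "y \<in> A" for y
        using n1[of n y] that by (simp add: n_def A_def abs_less_iff)
    qed (use b(1) fin in auto)
    also have "\<dots> \<le> ennreal (2 * \<eta>) * emeasure lborel (ball (0::'a) R)"
      by (intro mult_left_mono emeasure_mono) (auto simp: A_def)
    also have "emeasure lborel (ball (0::'a) R) = ennreal V"
      unfolding V_def using emeasure_lborel_ball_finite[of "0::'a" R]
      by (intro emeasure_eq_ennreal_measure) auto
    also have "ennreal (2 * \<eta>) * ennreal V = ennreal (2 * \<eta> * V)"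
      using \<eta> V by (simp add: ennreal_mult)
    also have "\<dots> \<le> ennreal e"
      using that V by (intro ennreal_leI) (simp add: \<eta>_def field_simps)
    finally show ?thesis by simp
  qed
  then have "emeasure lborel N \<le> 0" by (rule ennreal_le_epsilon)
  then have N: "N \<in> null_sets lborel" by (auto intro!: null_setsI)
  have "h -` {y. q y > 0} \<inter> K = K - N" by (auto simp: N_def F_def)
  then have "emeasure lebesgue (h -` {y. q y > 0} \<inter> K) = emeasure lborel (K - N)"
    by simp
  also have "\<dots> = emeasure lborel K" using N by (intro emeasure_Diff_null_set) auto
  finally show ?thesis by simp
qed

text \<open>
  The first summand bounds the tent of width \<open>b (Suc n)\<close>, the second one absorbs the changes from
  there to all smaller widths.
\<close>

definition cell_density :: "'a::euclidean_space itself \<Rightarrow> (nat \<Rightarrow> real) \<Rightarrow> nat \<Rightarrow> real" where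
  "cell_density _ b n = b (Suc n) / tent_mass TYPE('a) (b (Suc n)) + 1"

text \<open>The deterministic half of the argument. The steps on \<open>K\<close> give a continuous
  limit density \<open>q\<close>; the steps on cells bound the occupation of small balls during
  short time intervals. Over the set where \<open>q\<close> is positive these are the lower and
  upper bounds required by \<open>hausdorff_measure_fiber_pos\<close>.\<close>

lemma fibers_of_regular:
  fixes h :: "real \<Rightarrow> 'a::euclidean_space"
  assumes K: "compact K" "continuous_on K h" and [measurable]: "h \<in> borel_measurable borel"
    and \<phi>: "gauge_function \<phi>"
    and b: "\<And>n. b n > 0" "b \<longlonglongrightarrow> 0"
    and r: "\<And>n. r n > 0" "(\<lambda>n. r n * cell_density TYPE('a) b n) \<longlonglongrightarrow> 0"
    and r\<phi>: "\<And>n s. 0 < s \<Longrightarrow> s \<le> r n \<Longrightarrow> 6 * 2 ^ DIM('a) * cell_density TYPE('a) b (Suc n) * s \<le> \<phi> s"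
    and steps: "\<And>m y. m \<ge> m0 \<Longrightarrow> \<bar>smoothed (b m) K h y - smoothed (b (Suc m)) K h y\<bar> \<le> C / 2 ^ m"
    and cell_steps: "\<And>m n j y. m \<ge> m0 \<Longrightarrow> n < m \<Longrightarrow>
       \<bar>smoothed (b m) (K \<inter> cell (r n) j) h y - smoothed (b (Suc m)) (K \<inter> cell (r n) j) h y\<bar> \<le> r n / 2 ^ m"
  shows "\<exists>U. open U \<and> emeasure lebesgue (h -` U \<inter> K) = emeasure lebesgue K \<and>
           (\<forall>y\<in>U. hausdorff_measure \<phi> (h -` {y} \<inter> K) > 0)"
proof -
  let ?D = "cell_density TYPE('a) b"
  have [measurable]: "K \<in> sets borel" using K(1) by (simp add: borel_compact)
  have fin: "emeasure lborel K < \<infinity>" using K(1) by (rule emeasure_compact_finite)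
  have fin': "emeasure lborel (K \<inter> cell s j) < \<infinity>" for s j
    using emeasure_mono[of "K \<inter> cell s j" K lborel] fin by (auto intro: le_less_trans)
  have D: "?D n \<ge> 1" for n
    using b(1)[of "Suc n"] tent_mass_pos[OF b(1)[of "Suc n"], where 'a='a] by (simp add: cell_density_def)
  have \<phi>_nonneg: "\<phi> s \<ge> 0" if "s \<ge> 0" for s
    using \<phi> that by (metis atLeast_iff gauge_function_def mono_onD order_refl)
  have r0: "r \<longlonglongrightarrow> 0"
  proof (rule Lim_null_comparison[OF _ r(2)])
    show "\<forall>\<^sub>F n in sequentially. norm (r n) \<le> r n * ?D n"
      using r(1) D by (intro always_eventually allI) (simp add: less_imp_le)
  qed
  have small_b: "\<exists>M\<ge>N. b M \<le> \<epsilon>" if "\<epsilon> > 0" for N \<epsilon>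
    using order_tendstoD(2)[OF b(2) that]
    by (auto simp: eventually_sequentially) (metis less_imp_le nat_le_linear)

  \<comment> \<open>\<open>cell_steps\<close> speaks only of levels above \<open>n\<close>. The
    trivial bound is therefore used at width \<open>b (Suc n)\<close>, and all later changes add at
    most \<open>r n\<close>; together this is \<open>r n * ?D n\<close>. The power of 2 comes from
    doubling the ball so that it contains the tents of width
    \<open>b M \<le> \<epsilon>\<close>.\<close>
  have cell_density: "emeasure lborel {t\<in>K \<inter> cell (r n) j. h t \<in> ball y \<epsilon>}
      \<le> ennreal (r n * ?D n) * (2 ^ DIM('a) * emeasure lborel (ball y \<epsilon>))"
    if n: "n \<ge> m0" and \<epsilon>: "\<epsilon> > 0" for n j y \<epsilon>
  proof -
    obtain M where M: "M \<ge> Suc n" "b M \<le> \<epsilon>" using small_b[OF \<epsilon>] by blast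
    have "smoothed (b M) (K \<inter> cell (r n) j) h z \<le> r n * ?D n" for z
    proof -
      have "\<bar>smoothed (b (Suc n)) (K \<inter> cell (r n) j) h z - smoothed (b M) (K \<inter> cell (r n) j) h z\<bar>
          \<le> r n * (2 / 2 ^ Suc n - 2 / 2 ^ M)"
        by (rule telescope_bound[OF _ M(1)], rule cell_steps) (use n in auto)
      also have "\<dots> \<le> r n * 1"
      proof (intro mult_left_mono)
        have "2 / 2 ^ Suc n \<le> (1::real)" by simp
        moreover have "0 \<le> 2 / (2::real) ^ M" by simp
        ultimately show "2 / 2 ^ Suc n - 2 / 2 ^ M \<le> (1::real)" by linarith
      qed (use r(1)[of n] in simp)
      finally have "smoothed (b M) (K \<inter> cell (r n) j) h z \<le> smoothed (b (Suc n)) (K \<inter> cell (r n) j) h z + r n"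
        by linarith
      moreover have "smoothed (b (Suc n)) (K \<inter> cell (r n) j) h z
          \<le> measure lborel (K \<inter> cell (r n) j) * (b (Suc n) / tent_mass TYPE('a) (b (Suc n)))"
        by (rule smoothed_le) (use b(1) fin' in auto)
      moreover have "\<dots> \<le> r n * (b (Suc n) / tent_mass TYPE('a) (b (Suc n)))"
      proof (intro mult_right_mono)
        show "measure lborel (K \<inter> cell (r n) j) \<le> r n"
          using emeasure_Int_cell_le[OF r(1)[of n], of K j] r(1)[of n]
          by (simp add: measure_def enn2real_leI)
      qed (use b(1)[of "Suc n"] tent_mass_pos[OF b(1)[of "Suc n"], where 'a='a] in auto)
      ultimately show ?thesis by (simp add: cell_density_def algebra_simps)
    qed
    then have "emeasure lborel {t\<in>K \<inter> cell (r n) j. h t \<in> ball y \<epsilon>}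
        \<le> ennreal (r n * ?D n) * emeasure lborel (ball y (2 * \<epsilon>))"
    proof (intro occupation_le_smoothed[where b = "b M"])
      show "ball x (b M) \<subseteq> ball y (2 * \<epsilon>)" if "x \<in> ball y \<epsilon>" for x
      proof
        fix z assume "z \<in> ball x (b M)"
        then show "z \<in> ball y (2 * \<epsilon>)"
          using that M(2) dist_triangle[of y z x] by auto
      qed
    qed (use b(1) fin' in auto)
    then show ?thesis using \<epsilon> by (simp add: emeasure_ball_double)
  qed
  have interval_density: "emeasure lborel ({t\<in>K. h t \<in> ball y \<epsilon>} \<inter> {a<..<a+l})
      \<le> ennreal (3 * 2 ^ DIM('a) * ?D n * l) * emeasure lborel (ball y \<epsilon>)"
    if n: "n \<ge> m0" and \<epsilon>: "\<epsilon> > 0" and l: "r n \<le> l" for n y \<epsilon> a l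
  proof -
    have "{t\<in>K. h t \<in> ball y \<epsilon>} = K \<inter> (h -` ball y \<epsilon> \<inter> space borel)" by auto
    also have "\<dots> \<in> sets borel" by measurable
    finally have meas: "{t\<in>K. h t \<in> ball y \<epsilon>} \<in> sets borel" .
    have "emeasure lborel ({t\<in>K. h t \<in> ball y \<epsilon>} \<inter> {a<..<a+l})
        \<le> ennreal (3 * l) * (ennreal (?D n) * (2 ^ DIM('a) * emeasure lborel (ball y \<epsilon>)))"
    proof (rule emeasure_interval_le_cells[OF r(1) l meas])
      fix j
      have "{t\<in>K. h t \<in> ball y \<epsilon>} \<inter> cell (r n) j = {t\<in>K \<inter> cell (r n) j. h t \<in> ball y \<epsilon>}" by auto
      then show "emeasure lborel ({t\<in>K. h t \<in> ball y \<epsilon>} \<inter> cell (r n) j)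
        \<le> ennreal (r n) * (ennreal (?D n) * (2 ^ DIM('a) * emeasure lborel (ball y \<epsilon>)))"
        using cell_density[OF n \<epsilon>, of j y] r(1)[of n] D[of n] by (simp add: ennreal_mult mult.assoc)
    qed
    also have "\<dots> = ennreal (3 * 2 ^ DIM('a) * ?D n * l) * emeasure lborel (ball y \<epsilon>)"
      using r(1)[of n] D[of n] l
      by (simp add: ennreal_mult mult_ac flip: ennreal_power ennreal_numeral)
    finally show ?thesis .
  qed

  obtain q where q: "\<And>e. e > 0 \<Longrightarrow> \<exists>N. \<forall>n\<ge>N. \<forall>y. \<bar>smoothed (b n) K h y - q y\<bar> < e"
    using uniform_limit_of_summable_steps[where s = "\<lambda>m. smoothed (b m) K h", OF steps] by blast
  have cont_smoothed: "continuous_on UNIV (smoothed (b n) K h)" for n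
  proof (rule lipschitz_on_continuous_on, rule lipschitz_onI)
    fix x y :: 'a
    show "dist (smoothed (b n) K h x) (smoothed (b n) K h y)
        \<le> (measure lborel K / tent_mass TYPE('a) (b n)) * dist x y"
      using smoothed_lipschitz[of h h K "b n" x y "dist x y"] b(1) fin by (simp add: dist_norm)
  qed (use tent_mass_pos[OF b(1)[of n], where 'a='a] in auto)
  have q_cont: "continuous_on UNIV q"
  proof (rule uniform_limit_theorem[where F = sequentially])
    show "uniform_limit UNIV (\<lambda>n. smoothed (b n) K h) q sequentially"
      using q by (auto simp: uniform_limit_iff eventually_sequentially dist_real_def)
  qed (use cont_smoothed in auto)
  define U where "U = {y. q y > 0}"
  show ?thesis
  proof (intro exI[of _ U] conjI ballI)
    show "open U" unfolding U_def using q_cont by (intro open_Collect_less) auto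
    show "emeasure lebesgue (h -` U \<inter> K) = emeasure lebesgue K"
      unfolding U_def using occupation_density_full[OF K assms(3) b q_cont q] .
    fix y assume "y \<in> U"
    \<comment> \<open>As \<open>q y = 4 * c\<close>, \<open>q\<close> exceeds \<open>2 * c\<close>
      near \<open>y\<close>, and an approximation error below \<open>c\<close> still leaves smoothed
      densities above \<open>c\<close>.\<close>
    define c where "c = q y / 4"
    have c: "c > 0" using \<open>y \<in> U\<close> by (simp add: U_def c_def)
    have "open {z. q z > 2 * c}" using q_cont by (intro open_Collect_less) auto
    moreover have "y \<in> {z. q z > 2 * c}" using \<open>y \<in> U\<close> by (simp add: U_def c_def)
    ultimately obtain d where d: "d > 0" "ball y d \<subseteq> {z. q z > 2 * c}"
      by (meson openE)
    obtain N where N: "\<And>n y. n \<ge> N \<Longrightarrow> \<bar>smoothed (b n) K h y - q y\<bar> < c" using q[OF c] by blast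
    show "hausdorff_measure \<phi> (h -` {y} \<inter> K) > 0"
    proof (rule hausdorff_measure_fiber_pos[OF K assms(3) \<phi>])
      show "c / 2 ^ DIM('a) > 0" using c by simp
      show "d > 0" by fact
      fix \<epsilon> :: real assume \<epsilon>: "0 < \<epsilon>" "\<epsilon> < d"
      obtain M where M: "M \<ge> N" "b M \<le> \<epsilon> / 2" using small_b[of "\<epsilon> / 2" N] \<epsilon> by auto
      have "ennreal c * emeasure lborel (ball y (\<epsilon> / 2)) \<le> emeasure lborel {t\<in>K. h t \<in> ball y \<epsilon>}"
      proof (rule smoothed_le_occupation[where b = "b M"])
        show "ball x (b M) \<subseteq> ball y \<epsilon>" if "x \<in> ball y (\<epsilon> / 2)" for x
        proof
          fix z assume "z \<in> ball x (b M)"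
          then show "z \<in> ball y \<epsilon>"
            using that M(2) dist_triangle[of y z x] by auto
        qed
        show "c \<le> smoothed (b M) K h z" if "z \<in> ball y (\<epsilon> / 2)" for z
        proof -
          have "z \<in> ball y d" using that \<epsilon> by simp
          then have "q z > 2 * c" using d(2) by blast
          then show ?thesis using N[OF M(1), of z] by (simp add: abs_less_iff)
        qed
      qed (use b(1) fin in auto)
      moreover have "emeasure lborel (ball y \<epsilon>) = 2 ^ DIM('a) * emeasure lborel (ball y (\<epsilon> / 2))"
        using emeasure_ball_double[of "\<epsilon> / 2" y] \<epsilon> by simp
      moreover have "ennreal (c / 2 ^ DIM('a)) * 2 ^ DIM('a) = ennreal c"
      proof -
        have "ennreal (c / 2 ^ DIM('a)) * ennreal (2 ^ DIM('a)) = ennreal c"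
          using c by (subst ennreal_mult[symmetric]) auto
        then show ?thesis by (simp flip: ennreal_power)
      qed
      ultimately show "ennreal (c / 2 ^ DIM('a)) * emeasure lborel (ball y \<epsilon>) \<le> emeasure lborel {t\<in>K. h t \<in> ball y \<epsilon>}"
        by (simp add: mult.assoc[symmetric])
    next
      show "r m0 / 3 > 0" using r(1)[of m0] by simp
      fix s \<eta> :: real assume s: "0 \<le> s" "s \<le> r m0 / 3" and \<eta>: "\<eta> > 0"
      have "\<exists>n l. n \<ge> m0 \<and> s < l \<and> r n \<le> l \<and> 3 * 2 ^ DIM('a) * ?D n * l \<le> \<phi> s + \<eta>"
      proof (cases "s = 0")
        case True
        \<comment> \<open>For \<open>s = 0\<close> the gauge contributes nothing and
          \<open>\<eta>\<close> is the whole budget; an \<open>n\<close> that fits it exists because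
          \<open>r n * ?D n\<close> tends to 0.\<close>
        have "\<eta> / (3 * 2 ^ DIM('a)) > 0" using \<eta> by simp
        then obtain n where n: "n \<ge> m0" "r n * ?D n < \<eta> / (3 * 2 ^ DIM('a))"
          using order_tendstoD(2)[OF r(2)] unfolding eventually_sequentially
          by (metis nat_le_linear)
        have "3 * 2 ^ DIM('a) * ?D n * r n \<le> \<eta>" using n(2) by (simp add: field_simps)
        then show ?thesis
          using n True r(1)[of n] \<phi>_nonneg[of s] by (intro exI[of _ n] exI[of _ "r n"]) auto
      next
        case False
        then have "s > 0" using s by simp
        have ex: "\<exists>n. n \<ge> m0 \<and> r n \<le> 2 * s"
          using order_tendstoD(2)[OF r0, of "2 * s"] \<open>s > 0\<close> unfolding eventually_sequentially
          by (metis less_imp_le nat_le_linear mult_pos_pos zero_less_numeral)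
        \<comment> \<open>At the first scale not exceeding \<open>2 * s\<close>, the preceding scale
          \<open>r k\<close> is still at least \<open>s\<close>, so \<open>r\<phi>\<close> applies
          at \<open>k\<close> and involves \<open>?D (Suc k)\<close>, the density of the chosen
          scale. The preceding scale exists because \<open>s \<le> r m0 / 3\<close> excludes
          \<open>n = m0\<close>. Taking \<open>l = 2 * s\<close> turns the factor 3 of
          \<open>interval_density\<close> into the 6 of \<open>r\<phi>\<close>.\<close>
        define n where "n = (LEAST n. n \<ge> m0 \<and> r n \<le> 2 * s)"
        have n: "n \<ge> m0" "r n \<le> 2 * s" using LeastI_ex[OF ex] by (auto simp: n_def)
        have "n \<noteq> m0" using n(2) s r(1)[of m0] by auto
        then obtain k where k: "n = Suc k" "k \<ge> m0" using n(1) by (cases n) auto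
        have "\<not> (k \<ge> m0 \<and> r k \<le> 2 * s)"
          using not_less_Least[of k "\<lambda>n. n \<ge> m0 \<and> r n \<le> 2 * s"] k(1) by (simp add: n_def)
        then have "s \<le> r k" using k(2) \<open>s > 0\<close> by simp
        then have "6 * 2 ^ DIM('a) * ?D n * s \<le> \<phi> s" using r\<phi>[of s k] \<open>s > 0\<close> k by simp
        then show ?thesis
          using n \<open>s > 0\<close> \<eta> by (intro exI[of _ n] exI[of _ "2 * s"]) auto
      qed
      then obtain n l where nl: "n \<ge> m0" "s < l" "r n \<le> l" "3 * 2 ^ DIM('a) * ?D n * l \<le> \<phi> s + \<eta>" by blast
      show "\<exists>l>s. \<forall>a \<epsilon>. 0 < \<epsilon> \<longrightarrow>
         emeasure lborel ({t\<in>K. h t \<in> ball y \<epsilon>} \<inter> {a<..<a+l}) \<le> ennreal (\<phi> s + \<eta>) * emeasure lborel (ball y \<epsilon>)"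
      proof (intro exI[of _ l] conjI allI impI)
        fix a \<epsilon> :: real assume "0 < \<epsilon>"
        from interval_density[OF nl(1) this nl(3), of y a]
        show "emeasure lborel ({t\<in>K. h t \<in> ball y \<epsilon>} \<inter> {a<..<a+l}) \<le> ennreal (\<phi> s + \<eta>) * emeasure lborel (ball y \<epsilon>)"
          by (rule order_trans) (intro mult_right_mono ennreal_leI nl(4), simp)
      qed fact
    qed
  qed
qed

section \<open>Sums of nearly independent functions on a product space\<close>

context product_prob_space
begin

lemma measurable_resample:
  "i \<in> I \<Longrightarrow> (\<lambda>(x, \<xi>). \<xi>(i := x)) \<in> measurable (M i \<Otimes>\<^sub>M PiM I M) (PiM I M)"
  by (auto simp: split_beta' intro!: measurable_fun_upd[where J = I])

text \<open>On a cylinder the old value at \<open>i\<close> is forgotten, and the fresh value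
  contributes exactly the factor belonging to coordinate \<open>i\<close>. Agreement on cylinders
  determines the product measure.\<close>

lemma distr_resample:
  assumes i: "i \<in> I"
  shows "distr (M i \<Otimes>\<^sub>M PiM I M) (PiM I M) (\<lambda>(x, \<xi>). \<xi>(i := x)) = PiM I M"
proof (rule PiM_eq)
  fix J F assume J: "finite J" "J \<subseteq> I" and F: "\<And>j. j \<in> J \<Longrightarrow> F j \<in> sets (M j)"
  let ?A = "if i \<in> J then F i else space (M i)" and ?B = "prod_emb I M (J - {i}) (Pi\<^sub>E (J - {i}) F)"
  note [measurable] = measurable_resample[OF i]
  have B: "?B \<in> sets (PiM I M)" using J F by (intro sets_PiM_I) auto
  have "emeasure (distr (M i \<Otimes>\<^sub>M PiM I M) (PiM I M) (\<lambda>(x, \<xi>). \<xi>(i := x))) (prod_emb I M J (Pi\<^sub>E J F))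
    = emeasure (M i \<Otimes>\<^sub>M PiM I M)
        ((\<lambda>(x, \<xi>). \<xi>(i := x)) -` prod_emb I M J (Pi\<^sub>E J F) \<inter> space (M i \<Otimes>\<^sub>M PiM I M))"
    by (rule emeasure_distr) (use J F in \<open>auto intro!: sets_PiM_I measurable_resample[OF i]\<close>)
  also have "(\<lambda>(x, \<xi>). \<xi>(i := x)) -` prod_emb I M J (Pi\<^sub>E J F) \<inter> space (M i \<Otimes>\<^sub>M PiM I M) = ?A \<times> ?B"
    using F[of i, THEN sets.sets_into_space] i J
    by (auto simp: prod_emb_def space_pair_measure space_PiM PiE_iff extensional_def split: if_splits)
  also have "emeasure (M i \<Otimes>\<^sub>M PiM I M) (?A \<times> ?B) = emeasure (M i) ?A * emeasure (PiM I M) ?B"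
    by (rule P.emeasure_pair_measure_Times) (use B F in auto)
  also have "emeasure (PiM I M) ?B = (\<Prod>j\<in>J - {i}. emeasure (M j) (F j))"
    using J F by (intro emeasure_PiM_emb) auto
  also have "emeasure (M i) ?A * \<dots> = (\<Prod>j\<in>J. emeasure (M j) (F j))"
    using J prod.remove[of J i "\<lambda>j. emeasure (M j) (F j)"] M.emeasure_space_1[of i] by auto
  finally show "emeasure (distr (M i \<Otimes>\<^sub>M PiM I M) (PiM I M) (\<lambda>(x, \<xi>). \<xi>(i := x))) (prod_emb I M J (Pi\<^sub>E J F))
    = (\<Prod>j\<in>J. emeasure (M j) (F j))" .
qed simp

text \<open>Fubini's theorem for a fresh value paired with an old sample; boundedness gives
  integrability because the measures are probabilities.\<close>

lemma
  fixes f :: "('i \<Rightarrow> 'a) \<Rightarrow> real" and B :: real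
  assumes i: "i \<in> I" and f: "f \<in> borel_measurable (PiM I M)" "\<And>\<xi>. \<bar>f \<xi>\<bar> \<le> B"
  shows measurable_resample_integral: "(\<lambda>\<xi>. \<integral>x. f (\<xi>(i := x)) \<partial>M i) \<in> borel_measurable (PiM I M)"
    and integral_resample: "(\<integral>\<xi>. f \<xi> \<partial>PiM I M) = (\<integral>\<xi>. (\<integral>x. f (\<xi>(i := x)) \<partial>M i) \<partial>PiM I M)"
proof -
  interpret pair: pair_prob_space "M i" "PiM I M" ..
  have m: "(\<lambda>(x, \<xi>). f (\<xi>(i := x))) \<in> borel_measurable (M i \<Otimes>\<^sub>M PiM I M)"
    using measurable_compose[OF measurable_resample[OF i] f(1)] by (simp add: split_beta')
  have m': "(\<lambda>(\<xi>, x). f (\<xi>(i := x))) \<in> borel_measurable (PiM I M \<Otimes>\<^sub>M M i)"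
    using measurable_pair_swap[OF m] by (simp add: split_beta')
  show "(\<lambda>\<xi>. \<integral>x. f (\<xi>(i := x)) \<partial>M i) \<in> borel_measurable (PiM I M)"
    using M.borel_measurable_lebesgue_integral[OF m'] .
  have "integrable (M i \<Otimes>\<^sub>M PiM I M) (\<lambda>(x, \<xi>). f (\<xi>(i := x)))"
    by (rule pair.integrable_const_bound[where B = B]) (use f(2) m in auto)
  then have "(\<integral>\<xi>. (\<integral>x. f (\<xi>(i := x)) \<partial>M i) \<partial>PiM I M)
      = (\<integral>z. (\<lambda>(x, \<xi>). f (\<xi>(i := x))) z \<partial>(M i \<Otimes>\<^sub>M PiM I M))"
    by (rule pair.integral_snd)
  also have "\<dots> = (\<integral>z. f z \<partial>distr (M i \<Otimes>\<^sub>M PiM I M) (PiM I M) (\<lambda>(x, \<xi>). \<xi>(i := x)))"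
    by (subst integral_distr[OF measurable_resample[OF i] f(1)]) (simp add: split_beta')
  finally show "(\<integral>\<xi>. f \<xi> \<partial>PiM I M) = (\<integral>\<xi>. (\<integral>x. f (\<xi>(i := x)) \<partial>M i) \<partial>PiM I M)"
    by (simp add: distr_resample[OF i])
qed

text \<open>
  Subtracting from \<open>Q j\<close> its average over the single coordinate \<open>c j\<close> leaves summands that are
  orthogonal at distance at least two, so Chebyshev's inequality applies.
\<close>

lemma local_sum_deviation:
  fixes Q :: "int \<Rightarrow> ('i \<Rightarrow> 'a) \<Rightarrow> real" and J :: "int set" and B \<delta> :: real and e :: "int \<Rightarrow> real"
  assumes J: "finite J" and c: "\<And>j. c j \<in> I" "inj c"
    and meas: "\<And>j. Q j \<in> borel_measurable (PiM I M)"
    and B: "\<And>j \<xi>. \<bar>Q j \<xi>\<bar> \<le> B"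
    and local: "\<And>j j' \<xi> x. \<bar>j - j'\<bar> \<ge> 2 \<Longrightarrow> Q j' (\<xi>(c j := x)) = Q j' \<xi>"
    and e: "\<And>j \<xi>. j \<in> J \<Longrightarrow> \<bar>\<integral>x. Q j (\<xi>(c j := x)) \<partial>M (c j)\<bar> \<le> e j"
    and \<delta>: "\<delta> > 0"
  shows "P.prob {\<xi>\<in>space (PiM I M). \<bar>\<Sum>j\<in>J. Q j \<xi>\<bar> \<ge> (\<Sum>j\<in>J. e j) + \<delta>} \<le> 12 * card J * B\<^sup>2 / \<delta>\<^sup>2"
proof -
  define A where "A j \<xi> = (\<integral>x. Q j (\<xi>(c j := x)) \<partial>M (c j))" for j \<xi>
  define w where "w j \<xi> = Q j \<xi> - A j \<xi>" for j \<xi>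
  have [measurable]: "Q j \<in> borel_measurable (PiM I M)" "A j \<in> borel_measurable (PiM I M)" for j
    using meas measurable_resample_integral[OF c(1) meas B] by (simp_all add: A_def[abs_def])
  have w_meas[measurable]: "w j \<in> borel_measurable (PiM I M)" for j
    unfolding w_def[abs_def] by measurable
  have B0: "B \<ge> 0" using B abs_ge_zero order_trans by blast
  \<comment> \<open>Here \<open>\<xi>\<close> is arbitrary and may lie outside the sample space, so
    integrability is not guaranteed; in that case the integral is 0 by default.\<close>
  have A_le: "\<bar>A j \<xi>\<bar> \<le> B" for j \<xi>
  proof (cases "integrable (M (c j)) (\<lambda>x. Q j (\<xi>(c j := x)))")
    case True
    show ?thesis unfolding A_def
    proof (rule abs_leI)
      show "(\<integral>x. Q j (\<xi>(c j := x)) \<partial>M (c j)) \<le> B"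
        using B by (intro M.integral_le_const[OF True] AE_I2) (auto simp: abs_le_iff)
      have "- B \<le> (\<integral>x. Q j (\<xi>(c j := x)) \<partial>M (c j))"
        using B by (intro M.integral_ge_const[OF True] AE_I2) (auto simp: abs_le_iff minus_le_iff)
      then show "- (\<integral>x. Q j (\<xi>(c j := x)) \<partial>M (c j)) \<le> B" by simp
    qed
  next
    case False
    then show ?thesis using B0 by (simp add: A_def not_integrable_integral_eq)
  qed
  have w_le: "\<bar>w j \<xi>\<bar> \<le> 2 * B" for j \<xi>
    using B[of j \<xi>] A_le[of j \<xi>] by (simp add: w_def)
  have ww: "\<bar>w j \<xi> * w j' \<xi>\<bar> \<le> 4 * B\<^sup>2" for j j' \<xi>
    using mult_mono[OF w_le[of j \<xi>] w_le[of j' \<xi>]] B0 by (simp add: abs_mult power2_eq_square)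
  have int_ww: "integrable (PiM I M) (\<lambda>\<xi>. w j \<xi> * w j' \<xi>)" for j j'
    by (rule P.integrable_const_bound[where B = "4 * B\<^sup>2"]) (use ww in auto)
  \<comment> \<open>Coordinate \<open>c j\<close> is integrated first: \<open>w j'\<close> does not
    depend on it, and \<open>w j\<close> has mean zero in it.\<close>
  have orth: "(\<integral>\<xi>. w j \<xi> * w j' \<xi> \<partial>PiM I M) = 0" if far: "\<bar>j - j'\<bar> \<ge> 2" for j j'
  proof -
    have ne: "c j \<noteq> c j'" using far c(2) by (auto dest: injD)
    have inv: "w j' (\<xi>(c j := x)) = w j' \<xi>" for \<xi> x
    proof -
      have "A j' (\<xi>(c j := x)) = A j' \<xi>"
        unfolding A_def using local[OF far] ne by (simp add: fun_upd_twist)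
      then show ?thesis by (simp add: w_def local[OF far])
    qed
    have zero: "(\<integral>x. w j (\<xi>(c j := x)) \<partial>M (c j)) = 0" if \<xi>: "\<xi> \<in> space (PiM I M)" for \<xi>
    proof -
      have "(\<lambda>x. Q j (\<xi>(c j := x))) \<in> borel_measurable (M (c j))"
        using measurable_compose[OF measurable_Pair2' measurable_compose[OF measurable_resample[OF c(1)[of j]] meas[of j]], OF \<xi>]
        by simp
      then have "integrable (M (c j)) (\<lambda>x. Q j (\<xi>(c j := x)))"
        by (intro M.integrable_const_bound[where B = B]) (use B in auto)
      moreover have "A j (\<xi>(c j := x)) = A j \<xi>" for x by (simp add: A_def)
      ultimately show ?thesis by (simp add: w_def A_def[of j \<xi>, symmetric] M.prob_space)
    qed
    have "(\<integral>\<xi>. w j \<xi> * w j' \<xi> \<partial>PiM I M)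
        = (\<integral>\<xi>. (\<integral>x. w j (\<xi>(c j := x)) * w j' (\<xi>(c j := x)) \<partial>M (c j)) \<partial>PiM I M)"
      by (rule integral_resample[OF c(1) _ ww]) measurable
    also have "\<dots> = (\<integral>\<xi>. 0 \<partial>PiM I M)"
      by (rule Bochner_Integration.integral_cong) (simp_all add: inv zero)
    finally show ?thesis by simp
  qed
  \<comment> \<open>When the square is expanded, only pairs of indices at distance at most 1
    survive. That is at most three per row, each bounded by \<open>4 * B\<^sup>2\<close>, whence the
    12.\<close>
  have "(\<integral>\<xi>. (\<Sum>j\<in>J. w j \<xi>)\<^sup>2 \<partial>PiM I M) = (\<Sum>j\<in>J. \<Sum>j'\<in>J. (\<integral>\<xi>. w j \<xi> * w j' \<xi> \<partial>PiM I M))"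
    by (simp add: power2_eq_square sum_product int_ww)
  also have "\<dots> \<le> (\<Sum>j\<in>J. 12 * B\<^sup>2)"
  proof (rule sum_mono)
    fix j assume "j \<in> J"
    have "(\<Sum>j'\<in>J. (\<integral>\<xi>. w j \<xi> * w j' \<xi> \<partial>PiM I M))
        = (\<Sum>j'\<in>J \<inter> {j-1..j+1}. (\<integral>\<xi>. w j \<xi> * w j' \<xi> \<partial>PiM I M))"
    proof (rule sum.mono_neutral_right)
      show "\<forall>i\<in>J - J \<inter> {j-1..j+1}. (\<integral>\<xi>. w j \<xi> * w i \<xi> \<partial>PiM I M) = 0"
      proof
        fix i assume "i \<in> J - J \<inter> {j-1..j+1}"
        then have "\<bar>j - i\<bar> \<ge> 2" by auto
        then show "(\<integral>\<xi>. w j \<xi> * w i \<xi> \<partial>PiM I M) = 0" by (rule orth)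
      qed
    qed (use J in auto)
    also have "\<dots> \<le> (\<Sum>j'\<in>J \<inter> {j-1..j+1}. 4 * B\<^sup>2)"
    proof (rule sum_mono)
      fix j'
      have "(\<integral>\<xi>. w j \<xi> * w j' \<xi> \<partial>PiM I M) \<le> (\<integral>\<xi>. 4 * B\<^sup>2 \<partial>PiM I M)"
        using ww by (intro integral_mono int_ww) (auto simp: abs_le_iff)
      then show "(\<integral>\<xi>. w j \<xi> * w j' \<xi> \<partial>PiM I M) \<le> 4 * B\<^sup>2" by (simp add: P.prob_space)
    qed
    also have "\<dots> = real (card (J \<inter> {j-1..j+1})) * (4 * B\<^sup>2)" by simp
    also have "\<dots> \<le> 3 * (4 * B\<^sup>2)"
      using card_mono[of "{j-1..j+1}" "J \<inter> {j-1..j+1}"] by (intro mult_right_mono) auto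
    finally show "(\<Sum>j'\<in>J. (\<integral>\<xi>. w j \<xi> * w j' \<xi> \<partial>PiM I M)) \<le> 12 * B\<^sup>2" by simp
  qed
  finally have var: "(\<integral>\<xi>. (\<Sum>j\<in>J. w j \<xi>)\<^sup>2 \<partial>PiM I M) \<le> 12 * card J * B\<^sup>2"
    by simp
  have int2: "integrable (PiM I M) (\<lambda>\<xi>. (\<Sum>j\<in>J. w j \<xi>)\<^sup>2)"
    by (simp add: power2_eq_square sum_product int_ww)
  have "P.prob {\<xi>\<in>space (PiM I M). \<bar>\<Sum>j\<in>J. Q j \<xi>\<bar> \<ge> (\<Sum>j\<in>J. e j) + \<delta>}
      \<le> P.prob {\<xi>\<in>space (PiM I M). (\<Sum>j\<in>J. w j \<xi>)\<^sup>2 \<ge> \<delta>\<^sup>2}"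
  proof (rule P.finite_measure_mono)
    show "{\<xi>\<in>space (PiM I M). \<bar>\<Sum>j\<in>J. Q j \<xi>\<bar> \<ge> (\<Sum>j\<in>J. e j) + \<delta>}
        \<subseteq> {\<xi>\<in>space (PiM I M). (\<Sum>j\<in>J. w j \<xi>)\<^sup>2 \<ge> \<delta>\<^sup>2}"
    proof safe
      fix \<xi> assume h: "(\<Sum>j\<in>J. e j) + \<delta> \<le> \<bar>\<Sum>j\<in>J. Q j \<xi>\<bar>"
      have "\<bar>\<Sum>j\<in>J. A j \<xi>\<bar> \<le> (\<Sum>j\<in>J. \<bar>A j \<xi>\<bar>)" by (rule sum_abs)
      also have "\<dots> \<le> (\<Sum>j\<in>J. e j)" using e by (intro sum_mono) (simp add: A_def)
      finally have "\<delta> \<le> \<bar>\<Sum>j\<in>J. w j \<xi>\<bar>" using h by (simp add: w_def sum_subtractf)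
      then show "\<delta>\<^sup>2 \<le> (\<Sum>j\<in>J. w j \<xi>)\<^sup>2" using \<delta> by (simp add: abs_le_square_iff[symmetric])
    qed
  qed measurable
  \<comment> \<open>Chebyshev's inequality, as Markov's inequality for the square.\<close>
  also have "\<dots> \<le> (\<integral>\<xi>. (\<Sum>j\<in>J. w j \<xi>)\<^sup>2 \<partial>PiM I M) / \<delta>\<^sup>2"
    using integral_Markov_inequality_measure[OF int2, of "space (PiM I M)" "\<delta>\<^sup>2"] \<delta> by auto
  also have "\<dots> \<le> 12 * card J * B\<^sup>2 / \<delta>\<^sup>2"
    using var by (intro divide_right_mono) auto
  finally show ?thesis .
qed

end

section \<open>The noise\<close>

text \<open>
  Not a partition of unity: the bump of a cell equals 1 on the whole cell, so that there the noise is
  the vector belonging to the cell plus terms independent of it.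
\<close>

definition bump :: "real \<Rightarrow> int \<Rightarrow> real \<Rightarrow> real" where
  "bump r j t = max 0 (min 1 (2 - 2 * \<bar>t / r - of_int j - 1 / 2\<bar>))"

lemma bump_bounds: "0 \<le> bump r j t" "bump r j t \<le> 1"
  by (auto simp: bump_def)

lemma bump_eq_1:
  assumes "t \<in> cell r j" shows "bump r j t = 1"
proof -
  define u where "u = t / r"
  have "of_int j \<le> u" "u < of_int j + 1"
    using assms by (auto simp: cell_def u_def floor_eq_iff)
  then have "\<bar>u - of_int j - 1 / 2\<bar> \<le> 1 / 2" by (simp add: abs_le_iff field_simps)
  then show ?thesis by (simp add: bump_def u_def)
qed

lemma bump_eq_0: "t \<in> cell r j' \<Longrightarrow> \<bar>j - j'\<bar> \<ge> 2 \<Longrightarrow> bump r j t = 0"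
proof -
  assume t: "t \<in> cell r j'" and j: "\<bar>j - j'\<bar> \<ge> 2"
  define u where "u = t / r"
  have u: "of_int j' \<le> u" "u < of_int j' + 1"
    using t by (auto simp: cell_def u_def floor_eq_iff)
  have "j \<ge> j' + 2 \<or> j \<le> j' - 2" using j by linarith
  then have "of_int j \<ge> (of_int j' + 2 :: real) \<or> of_int j \<le> (of_int j' - 2 :: real)" by linarith
  then have "\<bar>u - of_int j - 1 / 2\<bar> \<ge> 1" using u by linarith
  then show ?thesis by (simp add: bump_def u_def)
qed

lemma continuous_on_bump: "r \<noteq> 0 \<Longrightarrow> continuous_on A (bump r j)"
  unfolding bump_def[abs_def] by (intro continuous_intros) auto

lemma borel_measurable_bump[measurable]: "bump r j \<in> borel_measurable borel"
  unfolding bump_def[abs_def] by measurable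

text \<open>
  Almost surely the noise vectors lie in the ball already; clipping makes the noise a continuous
  function for every sample point.
\<close>

definition clip :: "real \<Rightarrow> 'a::euclidean_space \<Rightarrow> 'a" where
  "clip a = closest_point (cball 0 a)"

lemma norm_clip_le: "a \<ge> 0 \<Longrightarrow> norm (clip a x) \<le> a"
  using closest_point_in_set[of "cball 0 a" x] by (auto simp: clip_def)

lemma clip_eq: "norm x \<le> a \<Longrightarrow> clip a x = x"
  by (simp add: clip_def closest_point_self)

lemma continuous_on_clip: "a \<ge> 0 \<Longrightarrow> continuous_on A (clip a)"
  unfolding clip_def by (rule continuous_on_closest_point) auto

lemma borel_measurable_clip: "a \<ge> 0 \<Longrightarrow> clip a \<in> borel_measurable borel"
  by (intro borel_measurable_continuous_onI continuous_on_clip)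

text \<open>Truncation at \<open>N m\<close> keeps each level a finite sum of continuous functions.
  Later \<open>N\<close> is taken so large that the cells carrying a vector cover
  \<open>K\<close>.\<close>

definition noise_level :: "(nat \<Rightarrow> real) \<Rightarrow> (nat \<Rightarrow> int) \<Rightarrow> (nat \<times> int \<Rightarrow> 'a::euclidean_space) \<Rightarrow> real \<Rightarrow> nat \<Rightarrow> 'a" where
  "noise_level r N \<xi> t m = (\<Sum>j\<in>{-N m..N m}. bump (r m) j t *\<^sub>R clip (1 / 2 ^ m) (\<xi> (m, j)))"

definition noise :: "(nat \<Rightarrow> real) \<Rightarrow> (nat \<Rightarrow> int) \<Rightarrow> (nat \<times> int \<Rightarrow> 'a::euclidean_space) \<Rightarrow> real \<Rightarrow> 'a" where
  "noise r N \<xi> t = (\<Sum>m. noise_level r N \<xi> t m)"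

text \<open>At any \<open>t\<close> at most three bumps are nonzero, those of the cell containing
  \<open>t\<close> and of its two neighbours, and clipping bounds each term.\<close>

lemma norm_noise_level_le: "norm (noise_level r N \<xi> t m) \<le> 3 * (1 / 2) ^ m"
proof -
  define i where "i = \<lfloor>t / r m\<rfloor>"
  have t: "t \<in> cell (r m) i" by (simp add: cell_def i_def)
  have "noise_level r N \<xi> t m = (\<Sum>j\<in>{-N m..N m} \<inter> {i-1..i+1}. bump (r m) j t *\<^sub>R clip (1 / 2 ^ m) (\<xi> (m, j)))"
    unfolding noise_level_def
  proof (rule sum.mono_neutral_right)
    show "\<forall>j\<in>{-N m..N m} - {-N m..N m} \<inter> {i-1..i+1}. bump (r m) j t *\<^sub>R clip (1 / 2 ^ m) (\<xi> (m, j)) = 0"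
    proof
      fix j assume "j \<in> {-N m..N m} - {-N m..N m} \<inter> {i-1..i+1}"
      then have "\<bar>j - i\<bar> \<ge> 2" by auto
      then show "bump (r m) j t *\<^sub>R clip (1 / 2 ^ m) (\<xi> (m, j)) = 0" using bump_eq_0[OF t] by simp
    qed
  qed auto
  also have "norm \<dots> \<le> (\<Sum>j\<in>{-N m..N m} \<inter> {i-1..i+1}. (1 / 2) ^ m)"
  proof (rule sum_norm_le)
    fix j
    have "norm (bump (r m) j t *\<^sub>R clip (1 / 2 ^ m) (\<xi> (m, j))) \<le> 1 * (1 / 2 ^ m)"
      unfolding norm_scaleR by (intro mult_mono norm_clip_le) (use bump_bounds[of "r m" j t] in auto)
    then show "norm (bump (r m) j t *\<^sub>R clip (1 / 2 ^ m) (\<xi> (m, j))) \<le> (1 / 2) ^ m"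
      by (simp add: power_one_over)
  qed
  also have "\<dots> = real (card ({-N m..N m} \<inter> {i-1..i+1})) * (1 / 2) ^ m" by simp
  also have "\<dots> \<le> 3 * (1 / 2) ^ m"
    using card_mono[of "{i-1..i+1}" "{-N m..N m} \<inter> {i-1..i+1}"] by (intro mult_right_mono) auto
  finally show ?thesis .
qed

lemma summable_geometric_half: "summable (\<lambda>m. 3 * (1 / 2 :: real) ^ m)"
  by (intro summable_mult summable_geometric) auto

lemma summable_noise_level: "summable (noise_level r N \<xi> t)"
  by (rule summable_comparison_test[OF _ summable_geometric_half]) (intro exI allI impI norm_noise_level_le)

lemma summable_norm_noise_level: "summable (\<lambda>m. norm (noise_level r N \<xi> t m))"
  by (rule summable_comparison_test[OF _ summable_geometric_half])
    (simp only: real_norm_def abs_norm_cancel, intro exI allI impI norm_noise_level_le)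

lemma norm_noise_le: "norm (noise r N \<xi> t) \<le> 6"
proof -
  have "norm (noise r N \<xi> t) \<le> (\<Sum>m. norm (noise_level r N \<xi> t m))"
    unfolding noise_def
    by (rule summable_norm[OF summable_norm_noise_level])
  also have "\<dots> \<le> (\<Sum>m. 3 * (1 / 2) ^ m)"
    by (intro suminf_le norm_noise_level_le summable_geometric_half summable_norm_noise_level)
  also have "\<dots> = 6" by (simp add: suminf_mult suminf_geometric)
  finally show ?thesis .
qed

lemma continuous_on_noise:
  assumes "\<And>m. r m > 0" shows "continuous_on A (noise r N \<xi>)"
proof (rule uniform_limit_theorem[where F = sequentially and f = "\<lambda>n t. \<Sum>m<n. noise_level r N \<xi> t m"])
  show "uniform_limit A (\<lambda>n t. \<Sum>m<n. noise_level r N \<xi> t m) (noise r N \<xi>) sequentially"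
    unfolding noise_def[abs_def]
    by (rule Weierstrass_m_test[OF norm_noise_level_le summable_geometric_half])
  show "\<forall>\<^sub>F n in sequentially. continuous_on A (\<lambda>t. \<Sum>m<n. noise_level r N \<xi> t m)"
    unfolding noise_level_def using assms
    by (intro always_eventually allI continuous_intros continuous_on_bump) (simp add: less_imp_neq[THEN not_sym])
qed simp

text \<open>Only level \<open>m\<close> changes, so the difference of the two series is a single
  term. Where the bump is 1, the new noise is \<open>clip (1 / 2 ^ m) x\<close> plus a term free of
  \<open>x\<close>, which is the form needed for averaging over \<open>x\<close>.\<close>

lemma noise_upd:
  "noise r N (\<xi>((m, j) := x)) t = noise r N \<xi> t +
    (if j \<in> {-N m..N m} then bump (r m) j t *\<^sub>R (clip (1 / 2 ^ m) x - clip (1 / 2 ^ m) (\<xi> (m, j))) else 0)"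
proof -
  have other: "noise_level r N (\<xi>((m, j) := x)) t k = noise_level r N \<xi> t k" if "k \<noteq> m" for k
    using that by (simp add: noise_level_def)
  have "noise r N (\<xi>((m, j) := x)) t - noise r N \<xi> t
      = (\<Sum>k. noise_level r N (\<xi>((m, j) := x)) t k - noise_level r N \<xi> t k)"
    unfolding noise_def by (rule suminf_diff) (rule summable_noise_level)+
  also have "\<dots> = noise_level r N (\<xi>((m, j) := x)) t m - noise_level r N \<xi> t m"
    by (subst suminf_finite[where N = "{m}"]) (auto simp: other)
  also have "\<dots> = (\<Sum>i\<in>{-N m..N m}. if i = j then bump (r m) j t *\<^sub>R (clip (1 / 2 ^ m) x - clip (1 / 2 ^ m) (\<xi> (m, j))) else 0)"
    unfolding noise_level_def sum_subtractf[symmetric]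
    by (intro sum.cong) (auto simp: scaleR_diff_right)
  finally show ?thesis by (simp add: algebra_simps)
qed

section \<open>The law of the noise vectors\<close>

text \<open>With a tent as density, averaging over a vector of level \<open>m\<close> convolves a
  kernel with \<open>tent (1 / 2 ^ m)\<close>, so \<open>tent_smoothing\<close> applies.\<close>

definition noise_law :: "nat \<times> int \<Rightarrow> 'a::euclidean_space measure" where
  "noise_law i = density lborel (\<lambda>x. ennreal (tent (1 / 2 ^ fst i) x))"

lemma sets_noise_law[simp, measurable_cong]: "sets (noise_law i) = sets borel"
  by (simp add: noise_law_def)

lemma space_noise_law[simp]: "space (noise_law i) = UNIV"
  by (simp add: noise_law_def)

lemma prob_space_noise_law: "prob_space (noise_law i :: 'a::euclidean_space measure)"
  using nn_integral_tent[of "1 / 2 ^ fst i" "0::'a"]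
  by (intro prob_spaceI) (simp add: noise_law_def emeasure_density)

lemma product_prob_space_noise_law: "product_prob_space (noise_law :: _ \<Rightarrow> 'a::euclidean_space measure)"
  using prob_space_noise_law by (intro product_prob_spaceI)

text \<open>Joint measurability in the sample and in \<open>t\<close> makes smoothed values
  measurable in the sample after integration over \<open>t\<close>.\<close>

lemma borel_measurable_noise_pair[measurable]:
  "(\<lambda>(\<xi>, t). noise r N \<xi> t :: 'a::euclidean_space) \<in> borel_measurable (PiM UNIV noise_law \<Otimes>\<^sub>M borel)"
proof -
  have [measurable]: "clip (1 / 2 ^ m) \<in> borel_measurable (borel :: 'a measure)" for m
    by (rule borel_measurable_clip) simp
  have [measurable]: "(\<lambda>\<xi>. \<xi> i :: 'a) \<in> borel_measurable (PiM UNIV noise_law)" for i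
    using measurable_component_singleton[of i UNIV noise_law] by (simp cong: measurable_cong_sets)
  show ?thesis unfolding noise_def noise_level_def split_beta' by measurable
qed

lemma borel_measurable_noise: "(\<lambda>t. noise r N \<xi> t) \<in> borel_measurable borel" for \<xi> :: "nat \<times> int \<Rightarrow> 'a::euclidean_space"
proof -
  have "\<xi> \<in> space (PiM UNIV (noise_law :: _ \<Rightarrow> 'a measure))" by (simp add: space_PiM)
  from measurable_compose[OF measurable_Pair1'[OF this] borel_measurable_noise_pair]
  show ?thesis by simp
qed

section \<open>Averaging over a single noise vector\<close>

text \<open>Fubini's theorem moves the average over \<open>x\<close> inside the integral over
  \<open>T\<close>. The clipping disappears because \<open>tent a\<close> vanishes wherever
  \<open>clip a x\<close> could differ from \<open>x\<close>, which leaves the convolution of two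
  tents.\<close>

lemma
  fixes u :: "real \<Rightarrow> 'a::euclidean_space"
  assumes a: "a > 0" and b: "b > 0" and [measurable]: "u \<in> borel_measurable borel" "T \<in> sets borel"
    and T: "emeasure lborel T < \<infinity>"
  defines "L \<equiv> density lborel (\<lambda>x::'a. ennreal (tent a x))"
  shows integrable_smoothed_clip: "integrable L (\<lambda>x. smoothed b T (\<lambda>t. u t + clip a x) y)"
    and set_integrable_tent_average: "set_integrable lborel T (\<lambda>t. \<integral>x. tent b (y - u t - x) * tent a x \<partial>lborel)"
    and integral_smoothed_clip: "(\<integral>x. smoothed b T (\<lambda>t. u t + clip a x) y \<partial>L)
      = (LINT t:T|lborel. (\<integral>x. tent b (y - u t - x) * tent a x \<partial>lborel))"
proof -
  have [measurable]: "clip a \<in> borel_measurable (borel :: 'a measure)"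
    using a by (intro borel_measurable_clip) simp
  have sets_L[simp, measurable_cong]: "sets L = sets borel" by (simp add: L_def)
  have "emeasure L UNIV = 1"
    using nn_integral_tent[OF a, of "0::'a"] by (simp add: L_def emeasure_density)
  moreover have space_L: "space L = UNIV" by (simp add: L_def)
  ultimately interpret L: prob_space L by (intro prob_spaceI) simp
  interpret pair: pair_sigma_finite L "lborel :: real measure" ..
  define F where "F x t = indicator T t * tent b (y - (u t + clip a x))" for x t
  have F: "integrable (L \<Otimes>\<^sub>M lborel) (case_prod F)"
  proof (rule integrableI_bounded_set[where A = "UNIV \<times> T" and B = "b / tent_mass TYPE('a) b"])
    show "case_prod F \<in> borel_measurable (L \<Otimes>\<^sub>M lborel)"
      unfolding F_def[abs_def] by measurable
    show "emeasure (L \<Otimes>\<^sub>M lborel) (UNIV \<times> T) < \<infinity>"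
      using T \<open>emeasure L UNIV = 1\<close> by (subst lborel.emeasure_pair_measure_Times) auto
    show "UNIV \<times> T \<in> sets (L \<Otimes>\<^sub>M lborel)" by (intro pair_measureI) auto
  qed (use b in \<open>auto simp: F_def tent_nonneg tent_le indicator_def\<close>)
  have sm: "smoothed b T (\<lambda>t. u t + clip a x) y = (\<integral>t. F x t \<partial>lborel)" for x
    by (simp add: smoothed_def set_lebesgue_integral_def F_def)
  show "integrable L (\<lambda>x. smoothed b T (\<lambda>t. u t + clip a x) y)"
    unfolding sm using pair.integrable_fst[OF F] .
  have av: "(\<integral>x. F x t \<partial>L) = indicator T t *\<^sub>R (\<integral>x. tent b (y - u t - x) * tent a x \<partial>lborel)" for t
  proof -
    have "(\<integral>x. F x t \<partial>L) = (\<integral>x. tent a x *\<^sub>R F x t \<partial>lborel)"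
      unfolding L_def by (rule integral_density) (use a in \<open>auto simp: F_def tent_nonneg\<close>)
    also have "\<dots> = (\<integral>x. indicator T t * (tent b (y - u t - x) * tent a x) \<partial>lborel)"
    proof (rule Bochner_Integration.integral_cong[OF refl])
      fix x :: 'a
      show "tent a x *\<^sub>R F x t = indicator T t * (tent b (y - u t - x) * tent a x)"
      proof (cases "norm x \<le> a")
        case True
        then show ?thesis by (simp add: F_def clip_eq diff_diff_eq)
      next
        case False
        then show ?thesis by (simp add: tent_eq_0)
      qed
    qed
    finally show ?thesis by simp
  qed
  show "set_integrable lborel T (\<lambda>t. \<integral>x. tent b (y - u t - x) * tent a x \<partial>lborel)"
    using pair.integrable_snd[OF F] by (simp add: set_integrable_def av)
  show "(\<integral>x. smoothed b T (\<lambda>t. u t + clip a x) y \<partial>L)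
      = (LINT t:T|lborel. (\<integral>x. tent b (y - u t - x) * tent a x \<partial>lborel))"
    unfolding sm set_lebesgue_integral_def av[symmetric] using pair.Fubini_integral[OF F] by simp
qed

text \<open>By \<open>tent_smoothing\<close> both averaged kernels are close to the same function
  \<open>tent a\<close>, whatever \<open>u\<close> is. This bounds the mean contribution of a
  cell.\<close>

lemma average_smoothed_diff:
  fixes u :: "real \<Rightarrow> 'a::euclidean_space"
  assumes a: "a > 0" and b: "b > 0" "b' > 0" and [measurable]: "u \<in> borel_measurable borel" "T \<in> sets borel"
    and T: "emeasure lborel T < \<infinity>"
  shows "\<bar>\<integral>x. smoothed b T (\<lambda>t. u t + clip a x) y - smoothed b' T (\<lambda>t. u t + clip a x) y
           \<partial>density lborel (\<lambda>x::'a. ennreal (tent a x))\<bar>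
       \<le> measure lborel T * ((b + b') / tent_mass TYPE('a) a)"
proof -
  define g where "g b t = (\<integral>x. tent b (y - u t - x) * tent a x \<partial>lborel)" for b t
  have g: "set_integrable lborel T (g c)"
    "(\<integral>x. smoothed c T (\<lambda>t. u t + clip a x) y \<partial>density lborel (\<lambda>x::'a. ennreal (tent a x))) = (LINT t:T|lborel. g c t)"
    if "c > 0" for c
    unfolding g_def[abs_def]
    using set_integrable_tent_average[OF a that assms(4,5) T] integral_smoothed_clip[OF a that assms(4,5) T] by auto
  have gd: "\<bar>g b t - g b' t\<bar> \<le> (b + b') / tent_mass TYPE('a) a" for t
    using tent_smoothing(2)[OF a b(1), of "y - u t"] tent_smoothing(2)[OF a b(2), of "y - u t"]
    unfolding g_def add_divide_distrib by linarith
  have gi: "set_integrable lborel T (\<lambda>t. g b t - g b' t)"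
    using g(1) b by (intro set_integral_diff)
  have "(\<integral>x. smoothed b T (\<lambda>t. u t + clip a x) y - smoothed b' T (\<lambda>t. u t + clip a x) y
           \<partial>density lborel (\<lambda>x::'a. ennreal (tent a x))) = (LINT t:T|lborel. g b t) - (LINT t:T|lborel. g b' t)"
    using integrable_smoothed_clip[OF a _ assms(4,5) T] b g(2) by (subst Bochner_Integration.integral_diff) auto
  also have "\<dots> = (LINT t:T|lborel. g b t - g b' t)"
    using g(1) b by (simp add: set_integral_diff)
  also have "\<bar>\<dots>\<bar> \<le> (LINT t:T|lborel. \<bar>g b t - g b' t\<bar>)"
    using set_integral_norm_bound[OF gi] by simp
  also have "\<dots> \<le> (LINT t:T|lborel. (b + b') / tent_mass TYPE('a) a)"
    using set_integrable_norm[OF gi] T gd by (intro set_integral_mono) (auto simp: set_integrable_def)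
  also have "\<dots> = measure lborel T * ((b + b') / tent_mass TYPE('a) a)"
    using T by (simp add: set_lebesgue_integral_def)
  finally show ?thesis .
qed

lemma smoothed_cong: "(\<And>t. t \<in> T \<Longrightarrow> h t = h' t) \<Longrightarrow> smoothed b T h y = smoothed b T h' y"
  unfolding smoothed_def set_lebesgue_integral_def
  by (rule Bochner_Integration.integral_cong) (auto simp: indicator_def)

lemma disjoint_cells: "disjoint_family_on (\<lambda>j. T \<inter> cell r j) J"
  by (auto simp: disjoint_family_on_def cell_def)

lemma smoothed_eq_sum_cells:
  fixes h :: "real \<Rightarrow> 'a::euclidean_space"
  assumes [measurable]: "h \<in> borel_measurable borel" "T \<in> sets borel"
    and T: "emeasure lborel T < \<infinity>" "T \<subseteq> (\<Union>j\<in>J. cell r j)" and b: "b > 0" and J: "finite J"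
  shows "smoothed b T h y = (\<Sum>j\<in>J. smoothed b (T \<inter> cell r j) h y)"
    and "measure lborel T = (\<Sum>j\<in>J. measure lborel (T \<inter> cell r j))"
proof -
  have eq: "T = (\<Union>j\<in>J. T \<inter> cell r j)" using T(2) by auto
  have fin: "emeasure lborel (T \<inter> cell r j) < \<infinity>" for j
    using emeasure_mono[of "T \<inter> cell r j" T lborel] T(1) by (auto intro: le_less_trans)
  show "smoothed b T h y = (\<Sum>j\<in>J. smoothed b (T \<inter> cell r j) h y)"
    unfolding smoothed_def using J b fin
    by (subst eq, intro set_integral_finite_Union disjoint_cells set_integrable_tent) auto
  show "measure lborel T = (\<Sum>j\<in>J. measure lborel (T \<inter> cell r j))"
    by (subst eq, rule measure_finite_Union) (use J disjoint_cells[of T r J] fin in \<open>auto simp: less_top\<close>)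
qed

text \<open>The contributions of the cells of level \<open>m\<close> are the summands of
  \<open>local_sum_deviation\<close>, with \<open>(m, j)\<close> as the coordinate belonging to cell
  \<open>j\<close>. Each is at most \<open>r m\<close> times the sum of the two tent heights, and
  its mean over that coordinate is controlled by \<open>average_smoothed_diff\<close>. The other
  levels stay frozen together with \<open>f\<close>.\<close>

lemma level_deviation:
  fixes f :: "real \<Rightarrow> 'a::euclidean_space" and r :: "nat \<Rightarrow> real" and N :: "nat \<Rightarrow> int" and m :: nat
  defines "h \<equiv> \<lambda>\<xi> t. f t + noise r N \<xi> t"
  assumes [measurable]: "f \<in> borel_measurable borel" "T \<in> sets borel"
    and T: "emeasure lborel T < \<infinity>" "T \<subseteq> (\<Union>j\<in>{-N m..N m}. cell (r m) j)"
    and r: "r m > 0" and b: "b > 0" "b' > 0" and \<delta>: "\<delta> > 0"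
  shows "measure (PiM UNIV noise_law) {\<xi>\<in>space (PiM UNIV noise_law).
           \<bar>smoothed b T (h \<xi>) y - smoothed b' T (h \<xi>) y\<bar>
             \<ge> measure lborel T * ((b + b') / tent_mass TYPE('a) (1 / 2 ^ m)) + \<delta>}
       \<le> 12 * card {-N m..N m} * (r m * (b / tent_mass TYPE('a) b + b' / tent_mass TYPE('a) b'))\<^sup>2 / \<delta>\<^sup>2"
proof -
  interpret product_prob_space "noise_law :: _ \<Rightarrow> 'a measure" UNIV
    by (rule product_prob_space_noise_law)
  define \<epsilon> where "\<epsilon> = (b + b') / tent_mass TYPE('a) (1 / 2 ^ m)"
  define \<beta> where "\<beta> = b / tent_mass TYPE('a) b + b' / tent_mass TYPE('a) b'"
  define J where "J = {-N m..N m}"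
  define Q where "Q j \<xi> = (if j \<in> J then smoothed b (T \<inter> cell (r m) j) (h \<xi>) y - smoothed b' (T \<inter> cell (r m) j) (h \<xi>) y else 0)"
    for j \<xi>
  have h_meas[measurable]: "h \<xi> \<in> borel_measurable borel" for \<xi>
    unfolding h_def using borel_measurable_noise[of r N \<xi>] by measurable
  have fin: "emeasure lborel (T \<inter> cell (r m) j) < \<infinity>" for j
    using emeasure_mono[of "T \<inter> cell (r m) j" T lborel] T(1) by (auto intro: le_less_trans)
  have sum_Q: "smoothed b T (h \<xi>) y - smoothed b' T (h \<xi>) y = (\<Sum>j\<in>J. Q j \<xi>)" for \<xi>
    using smoothed_eq_sum_cells(1)[OF h_meas assms(3) T(1) T(2)] b
    by (simp add: Q_def J_def sum_subtractf)
  have sum_e: "measure lborel T * \<epsilon> = (\<Sum>j\<in>J. measure lborel (T \<inter> cell (r m) j) * \<epsilon>)"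
    using smoothed_eq_sum_cells(2)[OF h_meas assms(3) T(1) T(2) b(1)]
    by (simp add: J_def sum_distrib_right)
  have "P.prob {\<xi>\<in>space (PiM UNIV noise_law). \<bar>\<Sum>j\<in>J. Q j \<xi>\<bar> \<ge> (\<Sum>j\<in>J. measure lborel (T \<inter> cell (r m) j) * \<epsilon>) + \<delta>}
      \<le> 12 * card J * (r m * \<beta>)\<^sup>2 / \<delta>\<^sup>2"
  proof (rule local_sum_deviation[where c = "\<lambda>j. (m, j)"])
    show "Q j \<in> borel_measurable (PiM UNIV noise_law)" for j
    proof -
      have "(\<lambda>\<xi>. smoothed c (T \<inter> cell (r m) j) (h \<xi>) y) \<in> borel_measurable (PiM UNIV noise_law)" for c
        unfolding smoothed_def set_lebesgue_integral_def h_def by measurable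
      then show ?thesis unfolding Q_def[abs_def] by measurable
    qed
    show "\<bar>Q j \<xi>\<bar> \<le> r m * \<beta>" for j \<xi>
    proof (cases "j \<in> J")
      case True
      have le: "smoothed c (T \<inter> cell (r m) j) (h \<xi>) y \<le> r m * (c / tent_mass TYPE('a) c)" if "c > 0" for c
      proof -
        have "measure lborel (T \<inter> cell (r m) j) \<le> r m"
          using emeasure_Int_cell_le[OF r, of T j] r by (simp add: measure_def enn2real_leI)
        then have "measure lborel (T \<inter> cell (r m) j) * (c / tent_mass TYPE('a) c) \<le> r m * (c / tent_mass TYPE('a) c)"
          using that tent_mass_pos[OF that, where 'a='a] by (intro mult_right_mono) auto
        then show ?thesis using smoothed_le[OF h_meas _ fin that, of j \<xi> y] by simp
      qed
      show ?thesis
        using le[OF b(1)] le[OF b(2)] smoothed_nonneg[OF b(1), of "T \<inter> cell (r m) j" "h \<xi>" y]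
          smoothed_nonneg[OF b(2), of "T \<inter> cell (r m) j" "h \<xi>" y] True
        by (simp add: Q_def \<beta>_def distrib_left abs_le_iff)
    next
      case False
      then show ?thesis
        using r b tent_mass_pos[OF b(1), where 'a='a] tent_mass_pos[OF b(2), where 'a='a] by (simp add: Q_def \<beta>_def)
    qed
    show "Q j' (\<xi>((m, j) := x)) = Q j' \<xi>" if "\<bar>j - j'\<bar> \<ge> 2" for j j' \<xi> x
    proof -
      have "smoothed c (T \<inter> cell (r m) j') (h (\<xi>((m, j) := x))) y = smoothed c (T \<inter> cell (r m) j') (h \<xi>) y" for c
        by (rule smoothed_cong) (use bump_eq_0[OF _ that, of _ "r m"] in \<open>auto simp: h_def noise_upd\<close>)
      then show ?thesis by (simp add: Q_def)
    qed
    show "\<bar>\<integral>x. Q j (\<xi>((m, j) := x)) \<partial>noise_law (m, j)\<bar> \<le> measure lborel (T \<inter> cell (r m) j) * \<epsilon>" if j: "j \<in> J" for j \<xi>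
    proof -
      \<comment> \<open>\<open>u\<close> is everything except the vector of cell \<open>j\<close>.
        The bump is 1 on that cell, so redrawing the vector just adds its clipped value to
        \<open>u\<close>.\<close>
      define u where "u t = h \<xi> t - clip (1 / 2 ^ m) (\<xi> (m, j))" for t
      have [measurable]: "u \<in> borel_measurable borel" unfolding u_def[abs_def] by measurable
      have "smoothed c (T \<inter> cell (r m) j) (h (\<xi>((m, j) := x))) y
          = smoothed c (T \<inter> cell (r m) j) (\<lambda>t. u t + clip (1 / 2 ^ m) x) y" for c x
        by (rule smoothed_cong) (use j in \<open>auto simp: h_def u_def noise_upd J_def bump_eq_1\<close>)
      then have "(\<integral>x. Q j (\<xi>((m, j) := x)) \<partial>noise_law (m, j))
          = (\<integral>x. smoothed b (T \<inter> cell (r m) j) (\<lambda>t. u t + clip (1 / 2 ^ m) x) y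
                 - smoothed b' (T \<inter> cell (r m) j) (\<lambda>t. u t + clip (1 / 2 ^ m) x) y
               \<partial>density lborel (\<lambda>x::'a. ennreal (tent (1 / 2 ^ m) x)))"
        using j by (simp add: Q_def noise_law_def)
      then show ?thesis
        using average_smoothed_diff[OF _ b \<open>u \<in> borel_measurable borel\<close> _ fin, of "1 / 2 ^ m" j y]
        by (simp add: \<epsilon>_def)
    qed
  qed (use \<delta> in \<open>auto simp: J_def intro: injI\<close>)
  then show ?thesis by (simp add: sum_Q sum_e J_def flip: \<epsilon>_def \<beta>_def)
qed

section \<open>Recursive choice of scales and the union bound\<close>

text \<open>\<open>G (Suc m) (r m)\<close> stands for the part of a union bound that is known once
  the preceding scale is. Each scale is therefore chosen after its predecessor; the absolute value
  and the added 1 keep the quotient positive for arbitrary \<open>G\<close>.\<close>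

lemma exists_scales:
  fixes G :: "nat \<Rightarrow> real \<Rightarrow> real" and \<rho> :: "nat \<Rightarrow> real"
  assumes \<rho>: "\<And>m. \<rho> m > 0"
  shows "\<exists>r. \<forall>m. 0 < r m \<and> r m \<le> \<rho> m \<and> r (Suc m) \<le> r m \<and> r (Suc m) * G (Suc m) (r m) \<le> 1 / 2 ^ Suc m"
proof -
  define step where "step m x = min (min (\<rho> (Suc m)) x) (1 / (2 ^ Suc m * (\<bar>G (Suc m) x\<bar> + 1)))" for m x
  define r where "r = rec_nat (\<rho> 0) step"
  have r: "r 0 = \<rho> 0" "\<And>m. r (Suc m) = step m (r m)" by (simp_all add: r_def)
  have pos: "0 < r m" for m
    by (induction m) (use \<rho> in \<open>auto simp: r step_def min_def add_nonneg_pos\<close>)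
  have "r (Suc m) * G (Suc m) (r m) \<le> 1 / 2 ^ Suc m" for m
  proof -
    define g where "g = G (Suc m) (r m)"
    have "r (Suc m) * g \<le> r (Suc m) * (\<bar>g\<bar> + 1)"
      using pos[of "Suc m"] by (intro mult_left_mono) auto
    also have "\<dots> \<le> 1 / (2 ^ Suc m * (\<bar>g\<bar> + 1)) * (\<bar>g\<bar> + 1)"
      by (intro mult_right_mono) (auto simp: r step_def g_def)
    also have "\<dots> = 1 / 2 ^ Suc m"
      by (simp add: add_nonneg_eq_0_iff)
    finally show ?thesis by (simp add: g_def)
  qed
  moreover have "r m \<le> \<rho> m" for m by (cases m) (auto simp: r step_def)
  moreover have "r (Suc m) \<le> r m" for m by (simp add: r step_def)
  ultimately show ?thesis using pos by blast
qed

lemma borel_measurable_smoothed_noise: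
  fixes f :: "real \<Rightarrow> 'a::euclidean_space"
  assumes [measurable]: "f \<in> borel_measurable borel" "T \<in> sets borel"
  shows "(\<lambda>\<xi>. smoothed c T (\<lambda>t. f t + noise r N \<xi> t) y) \<in> borel_measurable (PiM UNIV noise_law)"
  unfolding smoothed_def set_lebesgue_integral_def by measurable

lemma smoothed_eq_0:
  assumes "\<And>t. t \<in> T \<Longrightarrow> norm (y - h t) \<ge> b"
  shows "smoothed b T h y = 0"
proof -
  have "smoothed b T h y = (\<integral>t. (0::real) \<partial>(lborel :: real measure))"
    unfolding smoothed_def set_lebesgue_integral_def
    by (rule Bochner_Integration.integral_cong) (use assms in \<open>auto simp: indicator_def tent_eq_0\<close>)
  then show ?thesis by simp
qed

text \<open>The uncountable union over \<open>y\<close> is reduced to the net \<open>Y\<close>. For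
  \<open>y\<close> of norm above \<open>R + 7\<close> both smoothed values vanish, since the
  function is bounded by \<open>R + 6\<close> on \<open>K\<close> and the tents have width at most
  1; for other \<open>y\<close>, moving to the net costs at most \<open>\<delta>\<close>. Enclosing
  the samples in an event \<open>E\<close> avoids any question about measurability of the union
  itself.\<close>

lemma bad_event_bound:
  fixes f :: "real \<Rightarrow> 'a::euclidean_space" and r :: "nat \<Rightarrow> real" and N :: "nat \<Rightarrow> int" and m :: nat
    and \<T> :: "real set set" and Y :: "'a set"
  defines "h \<equiv> \<lambda>\<xi> t. f t + noise r N \<xi> t"
    and "\<beta> \<equiv> \<lambda>c. c / tent_mass TYPE('a) c"
  assumes [measurable]: "f \<in> borel_measurable borel" "K \<in> sets borel"
    and K: "emeasure lborel K < \<infinity>" "K \<subseteq> (\<Union>j\<in>{-N m..N m}. cell (r m) j)"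
    and \<T>: "finite \<T>" "\<And>T. T \<in> \<T> \<Longrightarrow> T \<in> sets borel" "\<And>T. T \<in> \<T> \<Longrightarrow> T \<subseteq> K"
    and r: "r m > 0" and b: "0 < b" "b \<le> 1" "0 < b'" "b' \<le> 1" and \<delta>: "\<delta> > 0"
    and \<epsilon>: "(b + b') / tent_mass TYPE('a) (1 / 2 ^ m) \<le> \<epsilon>"
    and f: "\<And>t. t \<in> K \<Longrightarrow> norm (f t) \<le> R"
    and Y: "finite Y" "cball 0 (R + 7) \<subseteq> (\<Union>y\<in>Y. ball y \<eta>)"
    and lip: "measure lborel K * (\<eta> / tent_mass TYPE('a) b + \<eta> / tent_mass TYPE('a) b') \<le> \<delta>"
  shows "\<exists>E\<in>sets (PiM UNIV noise_law).
      {\<xi>. \<exists>T\<in>\<T>. \<exists>y. \<bar>smoothed b T (h \<xi>) y - smoothed b' T (h \<xi>) y\<bar> > measure lborel T * \<epsilon> + 2 * \<delta>} \<subseteq> E \<and>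
      measure (PiM UNIV noise_law) E
        \<le> card \<T> * card Y * (12 * card {-N m..N m} * (r m * (\<beta> b + \<beta> b'))\<^sup>2 / \<delta>\<^sup>2)"
proof -
  interpret product_prob_space "noise_law :: _ \<Rightarrow> 'a measure" UNIV
    by (rule product_prob_space_noise_law)
  define F where "F T y = {\<xi>\<in>space (PiM UNIV noise_law).
           \<bar>smoothed b T (h \<xi>) y - smoothed b' T (h \<xi>) y\<bar>
             \<ge> measure lborel T * ((b + b') / tent_mass TYPE('a) (1 / 2 ^ m)) + \<delta>}" for T y
  define p where "p = 12 * card {-N m..N m} * (r m * (\<beta> b + \<beta> b'))\<^sup>2 / \<delta>\<^sup>2"
  have fin: "emeasure lborel T < \<infinity>" if "T \<in> \<T>" for T
    using emeasure_mono[of T K lborel] K(1) \<T>(3)[OF that] by (auto intro: le_less_trans)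
  have h_meas[measurable]: "h \<xi> \<in> borel_measurable borel" for \<xi>
    unfolding h_def using borel_measurable_noise[of r N \<xi>] by measurable
  have F_sets: "F T y \<in> sets (PiM UNIV noise_law)" if "T \<in> \<T>" for T y
  proof -
    have [measurable]: "(\<lambda>\<xi>. smoothed c T (h \<xi>) y) \<in> borel_measurable (PiM UNIV noise_law)" for c
      unfolding h_def by (rule borel_measurable_smoothed_noise) (use \<T>(2)[OF that] in auto)
    show ?thesis unfolding F_def by measurable
  qed
  have F_le: "P.prob (F T y) \<le> p" if "T \<in> \<T>" for T y
    unfolding F_def p_def \<beta>_def h_def
    by (rule level_deviation[where r = r and N = N and m = m, OF assms(3) \<T>(2)[OF that] fin[OF that] order_trans[OF \<T>(3)[OF that] K(2)] r b(1,3) \<delta>])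
  define E where "E = (\<Union>z\<in>\<T> \<times> Y. F (fst z) (snd z))"
  have "P.prob E \<le> (\<Sum>z\<in>\<T> \<times> Y. P.prob (F (fst z) (snd z)))"
    unfolding E_def using \<T>(1) Y(1) F_sets by (intro P.finite_measure_subadditive_finite) auto
  also have "\<dots> \<le> (\<Sum>z\<in>\<T> \<times> Y. p)" using F_le by (intro sum_mono) auto
  also have "\<dots> = card \<T> * card Y * p" by (simp add: card_cartesian_product)
  finally have E_le: "P.prob E \<le> card \<T> * card Y * p" .
  have "\<xi> \<in> E" if T: "T \<in> \<T>" and
    big: "\<bar>smoothed b T (h \<xi>) y' - smoothed b' T (h \<xi>) y'\<bar> > measure lborel T * \<epsilon> + 2 * \<delta>" for \<xi> T y'
  proof -
    have T_meas[measurable]: "T \<in> sets borel" by (rule \<T>(2)[OF T])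
    have \<epsilon>0: "\<epsilon> \<ge> 0"
      using \<epsilon> b tent_mass_pos[of "1 / 2 ^ m", where 'a='a] by (auto intro: order_trans[rotated])
    have "norm y' \<le> R + 7"
    proof (rule ccontr)
      assume "\<not> norm y' \<le> R + 7"
      have "norm (y' - h \<xi> t) \<ge> 1" if "t \<in> T" for t
      proof -
        have "norm (h \<xi> t) \<le> R + 6"
          unfolding h_def using f[of t] \<T>(3)[OF T] that norm_noise_le[of r N \<xi> t]
          by (intro norm_triangle_le) auto
        then show ?thesis
          using \<open>\<not> norm y' \<le> R + 7\<close> norm_triangle_ineq2[of y' "h \<xi> t"] by linarith
      qed
      then have "norm (y' - h \<xi> t) \<ge> b" "norm (y' - h \<xi> t) \<ge> b'" if "t \<in> T" for t
        using b that by (auto intro: order_trans)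
      then have "smoothed b T (h \<xi>) y' = 0" "smoothed b' T (h \<xi>) y' = 0"
        by (auto intro!: smoothed_eq_0)
      moreover have "0 \<le> measure lborel T * \<epsilon>" using \<epsilon>0 by simp
      ultimately show False using big \<delta> by simp
    qed
    then obtain y where y: "y \<in> Y" "dist y y' < \<eta>" using Y(2) by auto
    have lipc: "\<bar>smoothed c T (h \<xi>) y' - smoothed c T (h \<xi>) y\<bar> \<le> measure lborel K * (\<eta> / tent_mass TYPE('a) c)"
      if "c > 0" for c
    proof -
      have "\<bar>smoothed c T (h \<xi>) y' - smoothed c T (h \<xi>) y\<bar> \<le> measure lborel T * (\<eta> / tent_mass TYPE('a) c)"
        by (rule smoothed_lipschitz[OF h_meas h_meas T_meas fin[OF T] that])
          (use y(2) in \<open>auto simp: dist_norm norm_minus_commute\<close>)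
      also have "\<dots> \<le> measure lborel K * (\<eta> / tent_mass TYPE('a) c)"
      proof (intro mult_right_mono)
        show "measure lborel T \<le> measure lborel K"
          unfolding measure_def using emeasure_mono[OF \<T>(3)[OF T], of lborel] K(1)
          by (intro enn2real_mono) auto
        have "\<eta> > 0" using y(2) zero_le_dist[of y y'] by linarith
        then show "0 \<le> \<eta> / tent_mass TYPE('a) c" using tent_mass_pos[OF that, where 'a='a] by simp
      qed
      finally show ?thesis .
    qed
    have "measure lborel T * ((b + b') / tent_mass TYPE('a) (1 / 2 ^ m)) \<le> measure lborel T * \<epsilon>"
      using \<epsilon> by (intro mult_left_mono) auto
    \<comment> \<open>One of the two \<open>\<delta>\<close> in \<open>big\<close> pays for moving
      from \<open>y'\<close> to the net point \<open>y\<close>; the other is the deviation threshold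
      in \<open>F\<close>.\<close>
    then have "measure lborel T * ((b + b') / tent_mass TYPE('a) (1 / 2 ^ m)) + \<delta> \<le> \<bar>smoothed b T (h \<xi>) y - smoothed b' T (h \<xi>) y\<bar>"
      using big lipc[OF b(1)] lipc[OF b(3)] lip unfolding distrib_left by linarith
    then show ?thesis using T y(1) by (auto simp: E_def F_def space_PiM)
  qed
  then show ?thesis
    using E_le F_sets \<T>(1) Y(1)
    by (intro bexI[of _ E]) (auto simp: p_def E_def intro!: sets.finite_UN)
qed

section \<open>The maximum metric and open sets of continuous maps\<close>

lemma norm_diff_le_mdist:
  fixes f g :: "'a::metric_space \<Rightarrow> 'b::real_normed_vector"
  assumes K: "compact K" and f: "f \<in> carrier (C_group K)" and g: "g \<in> carrier (C_group K)" and t: "t \<in> K"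
  shows "norm (f t - g t) \<le> mdist (C_metric K) f g"
proof -
  have "compact ((\<lambda>x. norm (f x - g x)) ` K)"
    using f g K by (intro compact_continuous_image continuous_intros) (auto simp: carrier_C_group)
  then have "bdd_above ((\<lambda>x. norm (f x - g x)) ` K)"
    by (intro bounded_imp_bdd_above compact_imp_bounded)
  then have "norm (f t - g t) \<le> (SUP x\<in>K. norm (f x - g x))" using t by (intro cSUP_upper)
  moreover have "K \<noteq> {}" using t by auto
  ultimately show ?thesis by (simp only: mdist_C_metric[OF K _ f g] not_False_eq_True)
qed

lemma mdist_le_C_metric:
  fixes f g :: "'a::metric_space \<Rightarrow> 'b::real_normed_vector"
  assumes K: "compact K" "K \<noteq> {}" and f: "f \<in> carrier (C_group K)" and g: "g \<in> carrier (C_group K)"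
    and le: "\<And>t. t \<in> K \<Longrightarrow> norm (f t - g t) \<le> c"
  shows "mdist (C_metric K) f g \<le> c"
  using mdist_C_metric[OF K f g] le K(2) by (simp add: cSUP_least)

lemma openin_mtopology_of_iff:
  "openin (mtopology_of m) U \<longleftrightarrow> U \<subseteq> mspace m \<and>
    (\<forall>f\<in>U. \<exists>e>0. \<forall>g\<in>mspace m. mdist m f g < e \<longrightarrow> g \<in> U)"
proof -
  interpret Metric_space "mspace m" "mdist m"
    by (rule Metric_space_mspace_mdist)
  show ?thesis
    unfolding mtopology_of_def openin_mtopology mball_def
    by (intro conj_cong refl iffI ballI allI impI; blast)
qed

lemma openin_C_metric:
  fixes K :: "'a::metric_space set" and U :: "('a \<Rightarrow> 'b::real_normed_vector) set"
  shows "openin (mtopology_of (C_metric K)) U \<longleftrightarrow> U \<subseteq> carrier (C_group K) \<and>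
    (\<forall>f\<in>U. \<exists>e>0. \<forall>g\<in>carrier (C_group K). mdist (C_metric K) f g < e \<longrightarrow> g \<in> U)"
  unfolding C_group_def partial_object.select_convs by (rule openin_mtopology_of_iff)

lemma borel_measurable_zero_extension:
  fixes h :: "real \<Rightarrow> 'a::euclidean_space"
  assumes "compact K" "continuous_on K h"
  shows "(\<lambda>t. if t \<in> K then h t else 0) \<in> borel_measurable borel"
  using assms by (intro borel_measurable_continuous_on_if) (auto simp: borel_compact)

text \<open>For fixed \<open>y\<close> the smoothed values are Lipschitz in \<open>h\<close> with
  respect to the maximum metric, so a strict inequality survives small perturbations.\<close>

lemma openin_smoothed_diff:
  fixes K T :: "real set" and y :: "'a::euclidean_space"
  assumes K: "compact K" and T: "T \<in> sets borel" "T \<subseteq> K" and b: "b > 0" "b' > 0"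
  shows "openin (mtopology_of (C_metric K))
    {h \<in> carrier (C_group K). \<bar>smoothed b T h y - smoothed b' T h y\<bar> > \<theta>}"
  unfolding openin_C_metric
proof (intro conjI ballI, force)
  fix h :: "real \<Rightarrow> 'a"
  assume "h \<in> {h \<in> carrier (C_group K). \<bar>smoothed b T h y - smoothed b' T h y\<bar> > \<theta>}"
  then have h: "h \<in> carrier (C_group K)" and big: "\<bar>smoothed b T h y - smoothed b' T h y\<bar> > \<theta>" by auto
  have fin: "emeasure lborel T < \<infinity>"
    using emeasure_mono[of T K lborel] emeasure_compact_finite[OF K] T(2) K
    by (auto intro: le_less_trans simp: borel_compact)
  \<comment> \<open>Elements of the carrier are \<open>undefined\<close> off \<open>K\<close>.
    Extension by 0 gives Borel functions on the line and changes nothing on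
    \<open>T\<close>.\<close>
  define z where "z f t = (if t \<in> K then f t else 0)" for f :: "real \<Rightarrow> 'a" and t
  have z: "smoothed c T (z f) y = smoothed c T f y" for c f
    using T(2) by (intro smoothed_cong) (auto simp: z_def)
  have z_meas: "z f \<in> borel_measurable borel" if "f \<in> carrier (C_group K)" for f
    unfolding z_def[abs_def] using that K by (intro borel_measurable_zero_extension) (auto simp: carrier_C_group)
  define L where "L = measure lborel T / tent_mass TYPE('a) b + measure lborel T / tent_mass TYPE('a) b'"
  have L: "L \<ge> 0" using b tent_mass_pos[OF b(1), where 'a='a] tent_mass_pos[OF b(2), where 'a='a] by (simp add: L_def)
  \<comment> \<open>The gap above \<open>\<theta>\<close> divided by a Lipschitz constant; the added
    1 keeps the denominator positive when \<open>L = 0\<close>.\<close>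
  define e where "e = (\<bar>smoothed b T h y - smoothed b' T h y\<bar> - \<theta>) / (L + 1)"
  show "\<exists>e>0. \<forall>g\<in>carrier (C_group K). mdist (C_metric K) h g < e \<longrightarrow>
      g \<in> {h \<in> carrier (C_group K). \<bar>smoothed b T h y - smoothed b' T h y\<bar> > \<theta>}"
  proof (intro exI[of _ e] conjI ballI impI)
    show "e > 0" using big L by (simp add: e_def)
    fix g :: "real \<Rightarrow> 'a" assume g: "g \<in> carrier (C_group K)" and dist: "mdist (C_metric K) h g < e"
    have lip: "\<bar>smoothed c T h y - smoothed c T g y\<bar> \<le> measure lborel T * (mdist (C_metric K) h g / tent_mass TYPE('a) c)"
      if "c > 0" for c
      unfolding z[of c h, symmetric] z[of c g, symmetric]
    proof (rule smoothed_lipschitz[OF z_meas[OF h] z_meas[OF g] T(1) fin that])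
      fix t assume "t \<in> T"
      then show "norm ((y - z h t) - (y - z g t)) \<le> mdist (C_metric K) h g"
        using norm_diff_le_mdist[OF K h g, of t] T(2) by (auto simp: z_def norm_minus_commute)
    qed
    have nn: "0 \<le> mdist (C_metric K) h g" by simp
    have "L * mdist (C_metric K) h g \<le> (L + 1) * mdist (C_metric K) h g"
      by (intro mult_right_mono) auto
    also have "\<dots> < (L + 1) * e" using dist L by (intro mult_strict_left_mono) auto
    also have "\<dots> = \<bar>smoothed b T h y - smoothed b' T h y\<bar> - \<theta>" using L by (simp add: e_def)
    finally have "L * mdist (C_metric K) h g < \<bar>smoothed b T h y - smoothed b' T h y\<bar> - \<theta>" .
    moreover have "L * mdist (C_metric K) h g
        = measure lborel T * (mdist (C_metric K) h g / tent_mass TYPE('a) b) + measure lborel T * (mdist (C_metric K) h g / tent_mass TYPE('a) b')"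
      by (simp add: L_def field_simps)
    ultimately have "\<theta> < \<bar>smoothed b T g y - smoothed b' T g y\<bar>"
      using lip[OF b(1)] lip[OF b(2)] by linarith
    then show "g \<in> {h \<in> carrier (C_group K). \<bar>smoothed b T h y - smoothed b' T h y\<bar> > \<theta>}" using g by simp
  qed
qed

section \<open>Measurability of the noise as a random continuous map\<close>

lemma norm_noise_tail_le: "norm (noise r N \<xi> t - (\<Sum>m<M. noise_level r N \<xi> t m)) \<le> 6 / 2 ^ M"
proof -
  have s: "summable (\<lambda>m. 3 * (1 / 2 :: real) ^ (m + M))"
    using summable_ignore_initial_segment[OF summable_geometric_half, of M] .
  have s': "summable (\<lambda>m. norm (noise_level r N \<xi> t (m + M)))"
    using summable_ignore_initial_segment[OF summable_norm_noise_level, of r N \<xi> t M] .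
  have "noise r N \<xi> t - (\<Sum>m<M. noise_level r N \<xi> t m) = (\<Sum>m. noise_level r N \<xi> t (m + M))"
    unfolding noise_def by (simp add: suminf_minus_initial_segment[OF summable_noise_level])
  also have "norm \<dots> \<le> (\<Sum>m. norm (noise_level r N \<xi> t (m + M)))"
    by (rule summable_norm[OF s'])
  also have "\<dots> \<le> (\<Sum>m. 3 * (1 / 2) ^ (m + M))"
    by (intro suminf_le norm_noise_level_le s s')
  also have "\<dots> = (\<Sum>m. (3 * (1 / 2) ^ M) * (1 / 2) ^ m)"
    by (simp add: power_add mult_ac)
  also have "\<dots> = 6 / 2 ^ M"
    by (subst suminf_mult) (auto simp: suminf_geometric power_one_over)
  finally show ?thesis .
qed

text \<open>Finitely many vectors control the levels below \<open>M\<close> uniformly in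
  \<open>t\<close>, and the two tails cost \<open>6 / 2 ^ M\<close> each. This is continuity with
  respect to the product topology.\<close>

lemma norm_noise_diff_le:
  fixes e :: real
  assumes "\<And>m j. m < M \<Longrightarrow> j \<in> {-N m..N m} \<Longrightarrow> norm (clip (1 / 2 ^ m) (\<xi> (m, j)) - clip (1 / 2 ^ m) (\<zeta> (m, j))) \<le> e"
  shows "norm (noise r N \<xi> t - noise r N \<zeta> t) \<le> card (SIGMA m:{..<M}. {-N m..N m}) * e + 12 / 2 ^ M"
proof -
  have "norm ((\<Sum>m<M. noise_level r N \<xi> t m) - (\<Sum>m<M. noise_level r N \<zeta> t m))
      = norm (\<Sum>(m, j)\<in>(SIGMA m:{..<M}. {-N m..N m}). bump (r m) j t *\<^sub>R (clip (1 / 2 ^ m) (\<xi> (m, j)) - clip (1 / 2 ^ m) (\<zeta> (m, j))))"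
    by (simp add: noise_level_def sum.Sigma[symmetric] sum_subtractf scaleR_diff_right)
  also have "\<dots> \<le> (\<Sum>z\<in>(SIGMA m:{..<M}. {-N m..N m}). e)"
  proof (rule sum_norm_le)
    fix z assume "z \<in> (SIGMA m:{..<M}. {-N m..N m})"
    then obtain m j where z: "z = (m, j)" "m < M" "j \<in> {-N m..N m}" by auto
    have "bump (r m) j t * norm (clip (1 / 2 ^ m) (\<xi> (m, j)) - clip (1 / 2 ^ m) (\<zeta> (m, j)))
        \<le> 1 * norm (clip (1 / 2 ^ m) (\<xi> (m, j)) - clip (1 / 2 ^ m) (\<zeta> (m, j)))"
      by (intro mult_right_mono bump_bounds) auto
    also have "\<dots> \<le> e" using assms z by simp
    finally show "norm (case z of (m, j) \<Rightarrow> bump (r m) j t *\<^sub>R (clip (1 / 2 ^ m) (\<xi> (m, j)) - clip (1 / 2 ^ m) (\<zeta> (m, j)))) \<le> e"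
      using bump_bounds[of "r m" j t] z by simp
  qed
  finally have "norm ((\<Sum>m<M. noise_level r N \<xi> t m) - (\<Sum>m<M. noise_level r N \<zeta> t m)) \<le> card (SIGMA m:{..<M}. {-N m..N m}) * e"
    by simp
  moreover have "noise r N \<xi> t - noise r N \<zeta> t
      = (noise r N \<xi> t - (\<Sum>m<M. noise_level r N \<xi> t m)) + (((\<Sum>m<M. noise_level r N \<xi> t m) - (\<Sum>m<M. noise_level r N \<zeta> t m))
        - (noise r N \<zeta> t - (\<Sum>m<M. noise_level r N \<zeta> t m)))"
    by simp
  moreover have "norm \<dots> \<le> 6 / 2 ^ M + (norm ((\<Sum>m<M. noise_level r N \<xi> t m) - (\<Sum>m<M. noise_level r N \<zeta> t m)) + 6 / 2 ^ M)"
    by (intro order_trans[OF norm_triangle_ineq] order_trans[OF norm_triangle_ineq4] add_mono norm_noise_tail_le order_refl)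
  ultimately show ?thesis by simp
qed

text \<open>The map is continuous for the product topology, so preimages of open sets are open. The
  index set is countable, hence open sets of the product topology belong to the product
  sigma-algebra.\<close>

lemma measurable_noise_C:
  fixes K :: "real set"
  assumes K: "compact K" "K \<noteq> {}" and r: "\<And>m. r m > 0"
  shows "(\<lambda>\<xi>. \<lambda>t\<in>K. noise r N \<xi> t) \<in>
    measurable (PiM UNIV (noise_law :: _ \<Rightarrow> 'a::euclidean_space measure)) (borel_algebra (mtopology_of (C_metric K)))"
  unfolding borel_algebra_def
proof (rule measurable_measure_of)
  let ?S = "\<lambda>(\<xi> :: nat \<times> int \<Rightarrow> 'a). \<lambda>t\<in>K. noise r N \<xi> t"
  have S: "?S \<xi> \<in> carrier (C_group K)" for \<xi>
    using K(1) continuous_on_noise[OF r, where A = K and N = N and \<xi> = \<xi>] by (auto simp: carrier_C_group cong: continuous_on_cong)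
  then show "?S \<in> space (PiM UNIV noise_law) \<rightarrow> topspace (mtopology_of (C_metric K))"
    by (simp add: C_group_def)
  show "{U. openin (mtopology_of (C_metric K)) U} \<subseteq> Pow (topspace (mtopology_of (C_metric K)))"
    using openin_subset by blast
  fix U assume "U \<in> {U. openin (mtopology_of (C_metric K :: (real \<Rightarrow> 'a) metric)) U}"
  then have U: "openin (mtopology_of (C_metric K)) U" by simp
  have "open (?S -` U)"
  proof (subst open_subopen, intro ballI)
    fix \<zeta> assume "\<zeta> \<in> ?S -` U"
    then obtain e where e: "e > 0" "\<And>g. g \<in> carrier (C_group K) \<Longrightarrow> mdist (C_metric K) (?S \<zeta>) g < e \<Longrightarrow> g \<in> U"
      using U unfolding openin_C_metric by (metis vimageD)
    obtain M where M: "12 / 2 ^ M < e / 3"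
    proof -
      have "(\<lambda>M. 12 / 2 ^ M :: real) \<longlonglongrightarrow> 0" by (rule LIMSEQ_divide_realpow_zero) simp
      from order_tendstoD(2)[OF this, of "e / 3"] e(1) show ?thesis
        using that by (auto simp: eventually_sequentially)
    qed
    define I where "I = (SIGMA m:{..<M}. {-N m..N m})"
    define e' where "e' = e / (3 * (card I + 1))"
    have e': "e' > 0" using e(1) by (simp add: e'_def)
    define W where "W = (\<Inter>i\<in>I. {\<xi>. norm (clip (1 / 2 ^ fst i) (\<xi> i) - clip (1 / 2 ^ fst i) (\<zeta> i)) < e'})"
    have "open W" unfolding W_def
    proof (rule open_INT, simp add: I_def, intro ballI open_Collect_less)
      fix i :: "nat \<times> int"
      have "continuous_on UNIV (\<lambda>\<xi> :: nat \<times> int \<Rightarrow> 'a. clip (1 / 2 ^ fst i) (\<xi> i))"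
        using continuous_on_compose2[OF continuous_on_clip[of "1 / 2 ^ fst i" UNIV] continuous_on_product_coordinates[of i]]
        by simp
      then show "continuous_on UNIV (\<lambda>\<xi>. norm (clip (1 / 2 ^ fst i) (\<xi> i) - clip (1 / 2 ^ fst i) (\<zeta> i)))"
        by (intro continuous_intros)
    qed simp
    moreover have "\<zeta> \<in> W" using e' by (simp add: W_def)
    moreover have "W \<subseteq> ?S -` U"
    proof
      fix \<xi> assume \<xi>: "\<xi> \<in> W"
      have "mdist (C_metric K) (?S \<zeta>) (?S \<xi>) \<le> card I * e' + 12 / 2 ^ M"
      proof (rule mdist_le_C_metric[OF K S S])
        fix t assume "t \<in> K"
        have "norm (noise r N \<zeta> t - noise r N \<xi> t) \<le> card I * e' + 12 / 2 ^ M"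
          unfolding I_def by (rule norm_noise_diff_le)
            (use \<xi> in \<open>force simp: W_def I_def norm_minus_commute\<close>)
        then show "norm (?S \<zeta> t - ?S \<xi> t) \<le> card I * e' + 12 / 2 ^ M" using \<open>t \<in> K\<close> by simp
      qed
      moreover have "card I * e' \<le> e / 3" using e(1) by (simp add: e'_def field_simps)
      ultimately have "mdist (C_metric K) (?S \<zeta>) (?S \<xi>) < e" using M e(1) by simp
      then show "\<xi> \<in> ?S -` U" using e(2)[OF S] by simp
    qed
    ultimately show "\<exists>W. open W \<and> \<zeta> \<in> W \<and> W \<subseteq> ?S -` U" by blast
  qed
  then have "?S -` U \<in> sets (PiM UNIV (\<lambda>_. borel :: 'a measure))"
    by (simp add: sets_PiM_equal_borel)
  also have "sets (PiM UNIV (\<lambda>_. borel :: 'a measure)) = sets (PiM UNIV (noise_law :: _ \<Rightarrow> 'a measure))"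
    by (rule sets_PiM_cong) auto
  finally have "?S -` U \<in> sets (PiM UNIV noise_law)" .
  moreover have "space (PiM UNIV (noise_law :: _ \<Rightarrow> 'a measure)) = UNIV" by (simp add: space_PiM)
  ultimately show "?S -` U \<inter> space (PiM UNIV noise_law) \<in> sets (PiM UNIV noise_law)"
    by (simp only: Int_UNIV_right)
qed

section \<open>Prevalence\<close>

text \<open>The failure at level \<open>m\<close> of \<open>steps\<close> or
  \<open>cell_steps\<close> in \<open>fibers_of_regular\<close>. The strict inequalities make the
  set open, and only pieces of lengths \<open>r n\<close> with \<open>n < m\<close> are tested, so
  that their number is known before \<open>r m\<close> is chosen.\<close>

definition bad :: "real set \<Rightarrow> (nat \<Rightarrow> real) \<Rightarrow> (nat \<Rightarrow> real) \<Rightarrow> nat \<Rightarrow> (real \<Rightarrow> 'a::euclidean_space) set" where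
  "bad K b r m = {h \<in> carrier (C_group K).
     (\<exists>y. \<bar>smoothed (b m) K h y - smoothed (b (Suc m)) K h y\<bar> > (measure lborel K + 1) / 2 ^ m) \<or>
     (\<exists>n<m. \<exists>j y. \<bar>smoothed (b m) (K \<inter> cell (r n) j) h y - smoothed (b (Suc m)) (K \<inter> cell (r n) j) h y\<bar> > r n / 2 ^ m)}"

lemma openin_bad:
  fixes K :: "real set"
  assumes K: "compact K" and b: "\<And>m. b m > 0"
  shows "openin (mtopology_of (C_metric K)) (bad K b r m :: (real \<Rightarrow> 'a::euclidean_space) set)"
proof -
  define O1 where "O1 T \<theta> y = {h \<in> carrier (C_group K). \<bar>smoothed (b m) T h y - smoothed (b (Suc m)) T h y\<bar> > \<theta>}"
    for T \<theta> and y :: 'a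
  have O1: "openin (mtopology_of (C_metric K)) (O1 T \<theta> y)" if "T \<in> sets borel" "T \<subseteq> K" for T \<theta> y
    unfolding O1_def using openin_smoothed_diff[OF K that b b] .
  have "bad K b r m = (\<Union>y. O1 K ((measure lborel K + 1) / 2 ^ m) y) \<union>
      (\<Union>n\<in>{..<m}. \<Union>j. \<Union>y. O1 (K \<inter> cell (r n) j) (r n / 2 ^ m) y)"
    unfolding bad_def O1_def by auto
  also have "openin (mtopology_of (C_metric K)) \<dots>"
    by (intro openin_Un openin_Union ballI) (use K in \<open>auto intro!: O1 openin_Union simp: borel_compact\<close>)
  finally show ?thesis .
qed

text \<open>Bounds the indices of all cells of length at least \<open>x\<close> that meet the
  interval from \<open>-A\<close> to \<open>A\<close>; the bound for a fine scale thus serves all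
  coarser ones.\<close>

definition index_bound :: "real \<Rightarrow> real \<Rightarrow> int" where
  "index_bound A x = \<lceil>A / x\<rceil> + 1"

lemma cell_index_bound:
  assumes "t \<in> cell r j" "\<bar>t\<bar> \<le> A" "0 < x" "x \<le> r"
  shows "j \<in> {- index_bound A x..index_bound A x}"
proof -
  have "\<bar>t / r\<bar> \<le> A / x"
    using assms by (auto simp: abs_divide intro!: frac_le)
  then have "- (A / x) \<le> t / r" "t / r \<le> A / x" by linarith+
  moreover have "of_int j \<le> t / r" "t / r < of_int j + 1"
    using assms(1) by (auto simp: cell_def floor_eq_iff)
  ultimately show ?thesis unfolding index_bound_def by (auto; linarith)
qed

text \<open>An instance of \<open>bad_event_bound\<close> for a finite family containing
  \<open>K\<close> and all its nonempty pieces of lengths \<open>r n\<close>, \<open>n < m\<close>.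
  The hypothesis \<open>small\<close> compares \<open>r m\<close> with quantities that can be fixed
  as soon as \<open>r k\<close> is known.\<close>

lemma bad_step:
  fixes f :: "real \<Rightarrow> 'a::euclidean_space" and r :: "nat \<Rightarrow> real" and k :: nat
    and Y :: "'a set" and A R \<eta> :: real
  defines "N \<equiv> \<lambda>m. index_bound A (r m)" and "m \<equiv> Suc k" and "\<delta> \<equiv> r k / 2 ^ (k + 3)"
  assumes [measurable]: "f \<in> borel_measurable borel" and K: "compact K" "\<And>t. t \<in> K \<Longrightarrow> \<bar>t\<bar> \<le> A" "A > 0"
    and r: "\<And>n. r n > 0" "\<And>n. r (Suc n) \<le> r n" "\<And>n. r n \<le> 1"
    and b: "\<And>n. 0 < b n" "\<And>n. b n \<le> 1" "\<And>n. (b n + b (Suc n)) / tent_mass TYPE('a) (1 / 2 ^ n) \<le> 1 / 2 ^ Suc n"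
    and f: "\<And>t. t \<in> K \<Longrightarrow> norm (f t) \<le> R"
    and Y: "finite Y" "cball 0 (R + 7) \<subseteq> (\<Union>y\<in>Y. ball y \<eta>)"
    and lip: "measure lborel K * (\<eta> / tent_mass TYPE('a) (b m) + \<eta> / tent_mass TYPE('a) (b (Suc m))) \<le> \<delta>"
    and small: "r m * ((1 + m * card {-N k..N k}) * card Y *
        (12 * (2 * A + 5) * (b m / tent_mass TYPE('a) (b m) + b (Suc m) / tent_mass TYPE('a) (b (Suc m)))\<^sup>2 / \<delta>\<^sup>2)) \<le> 1 / 2 ^ m"
  shows "\<exists>E\<in>sets (PiM UNIV noise_law). measure (PiM UNIV noise_law) E \<le> 1 / 2 ^ m \<and>
      {\<xi>. \<exists>h\<in>bad K b r m. \<forall>t\<in>K. h t = f t + noise r N \<xi> t} \<subseteq> E"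
proof -
  define \<T> where "\<T> = insert K ((\<lambda>(n, j). K \<inter> cell (r n) j) ` ({..<m} \<times> {-N k..N k}))"
  define \<beta> where "\<beta> = b m / tent_mass TYPE('a) (b m) + b (Suc m) / tent_mass TYPE('a) (b (Suc m))"
  have r_mono: "r k \<le> r n" if "n < m" for n
    using lift_Suc_antimono_le[of r n k] r(2) that by (simp add: m_def)
  have \<delta>: "\<delta> > 0" using r(1)[of k] by (simp add: \<delta>_def)
  have [measurable]: "K \<in> sets borel" using K(1) by (simp add: borel_compact)
  have \<T>: "finite \<T>" "T \<in> \<T> \<Longrightarrow> T \<in> sets borel" "T \<in> \<T> \<Longrightarrow> T \<subseteq> K" for T
    by (auto simp: \<T>_def)
  have card_\<T>: "card \<T> \<le> 1 + m * card {-N k..N k}"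
  proof -
    have "card \<T> \<le> Suc (card ((\<lambda>(n, j). K \<inter> cell (r n) j) ` ({..<m} \<times> {-N k..N k})))"
      unfolding \<T>_def by (rule card_insert_le_m1[THEN order_trans]) auto
    also have "\<dots> \<le> Suc (card ({..<m} \<times> {-N k..N k}))"
      by (intro Suc_le_mono[THEN iffD2] card_image_le) auto
    finally show ?thesis by (simp add: card_cartesian_product)
  qed
  have cover: "K \<subseteq> (\<Union>j\<in>{-N m..N m}. cell (r m) j)"
  proof
    fix t assume "t \<in> K"
    moreover have "t \<in> cell (r m) \<lfloor>t / r m\<rfloor>" by (simp add: cell_def)
    ultimately show "t \<in> (\<Union>j\<in>{-N m..N m}. cell (r m) j)"
      using cell_index_bound[of t "r m" _ A "r m"] K(2) r(1) by (auto simp: N_def)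
  qed
  obtain E where E: "E \<in> sets (PiM UNIV noise_law)"
    "{\<xi>. \<exists>T\<in>\<T>. \<exists>y. \<bar>smoothed (b m) T (\<lambda>t. f t + noise r N \<xi> t) y - smoothed (b (Suc m)) T (\<lambda>t. f t + noise r N \<xi> t) y\<bar>
        > measure lborel T * (1 / 2 ^ Suc m) + 2 * \<delta>} \<subseteq> E"
    "measure (PiM UNIV noise_law) E \<le> card \<T> * card Y * (12 * card {-N m..N m} * (r m * \<beta>)\<^sup>2 / \<delta>\<^sup>2)"
    using bad_event_bound[where r = r and N = N and m = m and b = "b m" and b' = "b (Suc m)", OF assms(4) _ emeasure_compact_finite[OF K(1)]
        cover \<T> r(1) b(1,2) b(1,2) \<delta> b(3) f Y lip]
    by (auto simp: \<beta>_def)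
  have "measure (PiM UNIV noise_law) E \<le> 1 / 2 ^ m"
  proof -
    \<comment> \<open>There are about \<open>2 * A / r m\<close> indices; rounding and the margins
      of \<open>index_bound\<close> add at most 5, and \<open>r m \<le> 1\<close>.\<close>
    have c: "card {-N m..N m} * r m \<le> 2 * A + 5"
    proof -
      have "A / r m > 0" using K(3) r(1) by simp
      then have "real (card {-N m..N m}) = 2 * of_int \<lceil>A / r m\<rceil> + 3"
        by (simp add: N_def index_bound_def)
      also have "\<dots> \<le> 2 * (A / r m) + 5" by linarith
      finally have "card {-N m..N m} * r m \<le> (2 * (A / r m) + 5) * r m"
        using r(1)[of m] by (intro mult_right_mono) auto
      also have "\<dots> = 2 * A + 5 * r m" using r(1)[of m] by (simp add: field_simps)
      finally show ?thesis using r(3)[of m] by linarith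
    qed
    \<comment> \<open>The variance bound has a factor \<open>(r m)\<^sup>2\<close> for each of about
      \<open>1 / r m\<close> cells, so one factor \<open>r m\<close> remains to make the probability
      small.\<close>
    have "12 * card {-N m..N m} * (r m * \<beta>)\<^sup>2 / \<delta>\<^sup>2 = (card {-N m..N m} * r m) * (12 * r m * \<beta>\<^sup>2 / \<delta>\<^sup>2)"
      by (simp add: power2_eq_square field_simps)
    also have "\<dots> \<le> (2 * A + 5) * (12 * r m * \<beta>\<^sup>2 / \<delta>\<^sup>2)"
      using c r(1)[of m] by (intro mult_right_mono) auto
    finally have "card \<T> * card Y * (12 * card {-N m..N m} * (r m * \<beta>)\<^sup>2 / \<delta>\<^sup>2)
        \<le> real ((1 + m * card {-N k..N k}) * card Y) * ((2 * A + 5) * (12 * r m * \<beta>\<^sup>2 / \<delta>\<^sup>2))"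
      using card_\<T> by (intro mult_mono of_nat_mono mult_le_mono1) auto
    also have "\<dots> = r m * ((1 + m * card {-N k..N k}) * card Y * (12 * (2 * A + 5) * \<beta>\<^sup>2 / \<delta>\<^sup>2))"
      by (simp add: algebra_simps)
    also have "\<dots> \<le> 1 / 2 ^ m"
      using small unfolding \<beta>_def .
    finally show ?thesis using E(3) by linarith
  qed
  moreover have "\<xi> \<in> E" if h: "h \<in> bad K b r m" and eq: "\<forall>t\<in>K. h t = f t + noise r N \<xi> t" for h \<xi>
  proof -
    define D where "D T y = \<bar>smoothed (b m) T (\<lambda>t. f t + noise r N \<xi> t) y - smoothed (b (Suc m)) T (\<lambda>t. f t + noise r N \<xi> t) y\<bar>" for T y
    have D: "\<bar>smoothed (b m) T h y - smoothed (b (Suc m)) T h y\<bar> = D T y" if "T \<subseteq> K" for T y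
      unfolding D_def using that eq
      by (intro arg_cong[where f = abs] arg_cong2[where f = "(-)"] smoothed_cong) auto
    have "\<exists>T\<in>\<T>. \<exists>y. D T y > measure lborel T * (1 / 2 ^ Suc m) + 2 * \<delta>"
      using h unfolding bad_def mem_Collect_eq
    proof (elim conjE disjE exE)
      fix y assume "(measure lborel K + 1) / 2 ^ m < \<bar>smoothed (b m) K h y - smoothed (b (Suc m)) K h y\<bar>"
      then have "(measure lborel K + 1) / 2 ^ m < D K y" by (simp add: D)
      \<comment> \<open>By the choice of \<open>\<delta>\<close>,
        \<open>2 * \<delta> = r k / 2 ^ Suc m\<close>. Both thresholds in \<open>bad\<close> absorb
        this: here because \<open>r k \<le> 1\<close>, for the pieces below because
        \<open>r k \<le> r n\<close>.\<close>
      moreover have "measure lborel K * (1 / 2 ^ Suc m) + 2 * \<delta> \<le> (measure lborel K + 1) / 2 ^ m"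
      proof -
        have "2 * \<delta> = r k / 2 ^ Suc m" by (simp add: \<delta>_def m_def power_add field_simps)
        also have "\<dots> \<le> 1 / 2 ^ Suc m" using r(3)[of k] by (intro divide_right_mono) auto
        finally have "measure lborel K * (1 / 2 ^ Suc m) + 2 * \<delta> \<le> (measure lborel K + 1) / 2 ^ Suc m"
          by (simp add: add_divide_distrib)
        also have "\<dots> \<le> (measure lborel K + 1) / 2 ^ m"
          by (intro divide_left_mono) auto
        finally show ?thesis .
      qed
      ultimately have "measure lborel K * (1 / 2 ^ Suc m) + 2 * \<delta> < D K y" by linarith
      then show ?thesis by (auto simp: \<T>_def)
    next
      fix n j y
      assume n: "n < m" and big: "r n / 2 ^ m < \<bar>smoothed (b m) (K \<inter> cell (r n) j) h y - smoothed (b (Suc m)) (K \<inter> cell (r n) j) h y\<bar>"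
      \<comment> \<open>On an empty piece both smoothed values are 0. So the cell meets
        \<open>K\<close>, which confines \<open>j\<close> to the finite range belonging to
        \<open>r k\<close>.\<close>
      have "K \<inter> cell (r n) j \<noteq> {}"
      proof
        assume "K \<inter> cell (r n) j = {}"
        then show False using big r(1)[of n] by (simp add: smoothed_def set_lebesgue_integral_def divide_less_0_iff)
      qed
      then obtain t where t: "t \<in> K" "t \<in> cell (r n) j" by auto
      then have "j \<in> {-N k..N k}"
        using cell_index_bound[of t "r n" j A "r k"] K(2) r(1) r_mono[OF n] by (simp add: N_def)
      then have "K \<inter> cell (r n) j \<in> \<T>" using n by (auto simp: \<T>_def)
      moreover have "measure lborel (K \<inter> cell (r n) j) * (1 / 2 ^ Suc m) + 2 * \<delta> < D (K \<inter> cell (r n) j) y"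
      proof -
        have "measure lborel (K \<inter> cell (r n) j) \<le> r n"
          using emeasure_Int_cell_le[OF r(1)[of n], of K j] r(1)[of n] by (simp add: measure_def enn2real_leI)
        then have "measure lborel (K \<inter> cell (r n) j) * (1 / 2 ^ Suc m) \<le> r n * (1 / 2 ^ Suc m)"
          by (intro mult_right_mono) auto
        moreover have "2 * \<delta> = r k * (1 / 2 ^ Suc m)" by (simp add: \<delta>_def m_def power_add field_simps)
        moreover have "r k * (1 / 2 ^ Suc m) \<le> r n * (1 / 2 ^ Suc m)"
          using r_mono[OF n] by (intro mult_right_mono) auto
        moreover have "r n * (1 / 2 ^ Suc m) + r n * (1 / 2 ^ Suc m) = r n / 2 ^ m" by (simp add: field_simps)
        ultimately show ?thesis using big by (simp add: D)
      qed
      ultimately show ?thesis by blast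
    qed
    then show ?thesis using E(2) unfolding D_def by blast
  qed
  ultimately show ?thesis using E(1) by blast
qed

lemma openin_borel_algebra: "openin T U \<Longrightarrow> U \<in> sets (borel_algebra T)"
  unfolding borel_algebra_def by (rule in_measure_of) (auto dest: openin_subset)

section \<open>Tent widths, nets and gauge thresholds\<close>

text \<open>The width is small against the tent mass at the noise amplitude
  \<open>1 / 2 ^ m\<close>, which controls the bias left after averaging; the exponent
  \<open>m + 2\<close> makes two consecutive widths together fit under \<open>1 / 2 ^ Suc m\<close>
  of that mass. The minimum with 1 makes the bound by 1 and the convergence to 0 evident.\<close>

definition width :: "'a::euclidean_space itself \<Rightarrow> nat \<Rightarrow> real" where
  "width _ m = min (tent_mass TYPE('a) (1 / 2 ^ m)) 1 / 2 ^ (m + 2)"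

lemma width:
  shows "width TYPE('a::euclidean_space) m > 0" "width TYPE('a) m \<le> 1"
    and "(width TYPE('a) m + width TYPE('a) (Suc m)) / tent_mass TYPE('a) (1 / 2 ^ m) \<le> 1 / 2 ^ Suc m"
    and "width TYPE('a) \<longlonglongrightarrow> 0"
proof -
  have pos: "tent_mass TYPE('a) (1 / 2 ^ m) > 0" for m by (rule tent_mass_pos) simp
  show "width TYPE('a) m > 0" using pos by (simp add: width_def)
  have le: "width TYPE('a) m \<le> (1 / 2) ^ m" for m
  proof -
    have "width TYPE('a) m \<le> 1 / 2 ^ (m + 2)" unfolding width_def by (intro divide_right_mono) auto
    also have "\<dots> \<le> 1 / 2 ^ m" by (intro divide_left_mono power_increasing) auto
    finally show ?thesis by (simp add: power_one_over)
  qed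
  show "width TYPE('a) m \<le> 1" using le[of m] power_le_one[of "1 / 2 :: real" m] by linarith
  show "width TYPE('a) \<longlonglongrightarrow> 0"
  proof (rule tendsto_sandwich[OF _ _ tendsto_const])
    show "(\<lambda>m. (1 / 2 :: real) ^ m) \<longlonglongrightarrow> 0" by (rule LIMSEQ_power_zero) simp
  qed (use le pos in \<open>auto simp: width_def intro!: always_eventually less_imp_le\<close>)
  define M where "M = tent_mass TYPE('a) (1 / 2 ^ m)"
  have M: "M > 0" using pos by (simp add: M_def)
  have "width TYPE('a) m \<le> M / 2 ^ (m + 2)"
    unfolding width_def M_def by (intro divide_right_mono) auto
  moreover have "width TYPE('a) (Suc m) \<le> M / 2 ^ (m + 2)"
    unfolding width_def M_def
  proof (intro frac_le)
    have "tent_mass TYPE('a) (1 / 2 ^ Suc m) \<le> tent_mass TYPE('a) (1 / 2 ^ m)"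
      by (intro tent_mass_mono) (simp add: field_simps)
    then show "min (tent_mass TYPE('a) (1 / 2 ^ Suc m)) 1 \<le> tent_mass TYPE('a) (1 / 2 ^ m)" by linarith
  qed (use M in \<open>auto simp: M_def\<close>)
  ultimately have "width TYPE('a) m + width TYPE('a) (Suc m) \<le> M / 2 ^ (m + 2) + M / 2 ^ (m + 2)" by linarith
  also have "\<dots> = M / 2 ^ Suc m" by (simp add: field_simps)
  finally have "(width TYPE('a) m + width TYPE('a) (Suc m)) / M \<le> (M / 2 ^ Suc m) / M"
    using M by (intro divide_right_mono) auto
  then show "(width TYPE('a) m + width TYPE('a) (Suc m)) / tent_mass TYPE('a) (1 / 2 ^ m) \<le> 1 / 2 ^ Suc m"
    using M by (simp add: M_def)
qed

text \<open>Positivity of \<open>\<eta>\<close> stands inside the existence claim so that a finite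
  set can be selected for all parameters at once.\<close>

lemma finite_net: "\<exists>Y. finite Y \<and> (\<eta> > 0 \<longrightarrow> cball (0::'a::euclidean_space) R \<subseteq> (\<Union>y\<in>Y. ball y \<eta>))"
proof (cases "\<eta> > 0")
  case True
  then show ?thesis
    using compact_cball[of "0::'a" R] unfolding compact_eq_totally_bounded by blast
qed auto

lemma gauge_dominates_linear:
  assumes "filterlim (\<lambda>r. \<phi> r / r) at_top (at_right (0::real))"
  shows "\<exists>\<rho>>0. \<forall>s. 0 < s \<longrightarrow> s \<le> \<rho> \<longrightarrow> C * s \<le> \<phi> s"
proof -
  have "\<forall>\<^sub>F s in at_right 0. C \<le> \<phi> s / s" using assms by (simp add: filterlim_at_top)
  then obtain c where c: "c > 0" "\<And>s. 0 < s \<Longrightarrow> s < c \<Longrightarrow> C \<le> \<phi> s / s"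
    by (auto simp: eventually_at_right_field)
  have "C * s \<le> \<phi> s" if "0 < s" "s \<le> c / 2" for s
    using c(2)[of s] that c(1) by (simp add: field_simps)
  then show ?thesis using c(1) by (intro exI[of _ "c / 2"]) auto
qed


section \<open>Borel-Cantelli and prevalence\<close>

text \<open>The scales must be the same for all \<open>f\<close>, although the bound
  \<open>R\<close> is arbitrary. The net at step \<open>k\<close> therefore serves functions bounded
  by \<open>k\<close>, which includes \<open>f\<close> from some \<open>k0\<close> on. The
  probabilities from \<open>bad_step\<close> are summable, so the Borel-Cantelli lemma
  applies.\<close>

lemma limsup_bad_null:
  fixes f :: "real \<Rightarrow> 'a::euclidean_space" and r b :: "nat \<Rightarrow> real" and Y :: "nat \<Rightarrow> 'a set" and A :: real
  defines "N \<equiv> \<lambda>m. index_bound A (r m)" and "\<delta> \<equiv> \<lambda>k. r k / 2 ^ (k + 3)"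
  assumes f: "f \<in> borel_measurable borel" "\<And>t. t \<in> K \<Longrightarrow> norm (f t) \<le> R"
    and K: "compact K" "\<And>t. t \<in> K \<Longrightarrow> \<bar>t\<bar> \<le> A" "A > 0"
    and r: "\<And>n. r n > 0" "\<And>n. r (Suc n) \<le> r n" "\<And>n. r n \<le> 1"
    and b: "\<And>n. 0 < b n" "\<And>n. b n \<le> 1" "\<And>n. (b n + b (Suc n)) / tent_mass TYPE('a) (1 / 2 ^ n) \<le> 1 / 2 ^ Suc n"
    and Y: "\<And>k. finite (Y k)" "\<And>k. cball 0 (real k + 7) \<subseteq> (\<Union>y\<in>Y k. ball y (\<eta> k))"
    and lip: "\<And>k. measure lborel K * (\<eta> k / tent_mass TYPE('a) (b (Suc k)) + \<eta> k / tent_mass TYPE('a) (b (Suc (Suc k)))) \<le> \<delta> k"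
    and small: "\<And>k. r (Suc k) * ((1 + Suc k * card {-N k..N k}) * card (Y k) *
        (12 * (2 * A + 5) * (b (Suc k) / tent_mass TYPE('a) (b (Suc k)) + b (Suc (Suc k)) / tent_mass TYPE('a) (b (Suc (Suc k))))\<^sup>2 / (\<delta> k)\<^sup>2))
      \<le> 1 / 2 ^ Suc k"
  shows "\<exists>E\<in>null_sets (PiM UNIV noise_law).
      {\<xi>. \<exists>h\<in>(\<Inter>m0. \<Union>m\<in>{m0..}. bad K b r m). \<forall>t\<in>K. h t = f t + noise r N \<xi> t} \<subseteq> E"
proof -
  interpret product_prob_space "noise_law :: _ \<Rightarrow> 'a measure" UNIV
    by (rule product_prob_space_noise_law)
  obtain k0 :: nat where k0: "R \<le> real k0" using real_arch_simple by blast
  \<comment> \<open>Before \<open>k0\<close> nothing has to be covered and the empty event is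
    taken.\<close>
  have "\<forall>k. \<exists>E\<in>sets (PiM UNIV noise_law). measure (PiM UNIV noise_law) E \<le> 1 / 2 ^ Suc k \<and>
      (k \<ge> k0 \<longrightarrow> {\<xi>. \<exists>h\<in>bad K b r (Suc k). \<forall>t\<in>K. h t = f t + noise r N \<xi> t} \<subseteq> E)"
  proof
    fix k
    show "\<exists>E\<in>sets (PiM UNIV noise_law). measure (PiM UNIV noise_law) E \<le> 1 / 2 ^ Suc k \<and>
      (k \<ge> k0 \<longrightarrow> {\<xi>. \<exists>h\<in>bad K b r (Suc k). \<forall>t\<in>K. h t = f t + noise r N \<xi> t} \<subseteq> E)"
    proof (cases "k \<ge> k0")
      case True
      then have "norm (f t) \<le> real k" if "t \<in> K" for t using f(2)[OF that] k0 by linarith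
      from bad_step[OF f(1) K r b this Y(1) Y(2) lip[unfolded \<delta>_def] small[unfolded \<delta>_def N_def]]
      show ?thesis unfolding N_def by blast
    qed (auto intro!: bexI[of _ "{}"])
  qed
  from choice[OF this[unfolded Bex_def]] obtain E where E: "\<And>k. E k \<in> sets (PiM UNIV noise_law)"
    "\<And>k. measure (PiM UNIV noise_law) (E k) \<le> 1 / 2 ^ Suc k"
    "\<And>k. k \<ge> k0 \<Longrightarrow> {\<xi>. \<exists>h\<in>bad K b r (Suc k). \<forall>t\<in>K. h t = f t + noise r N \<xi> t} \<subseteq> E k"
    by blast
  have "summable (\<lambda>k. P.prob (E k))"
  proof (rule summable_comparison_test'[OF summable_geometric[of "1 / 2 :: real"]])
    show "norm (P.prob (E k)) \<le> (1 / 2) ^ k" for k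
    proof -
      have "P.prob (E k) \<le> 1 / 2 ^ Suc k" by (rule E(2))
      also have "\<dots> \<le> (1 / 2) ^ k" by (simp add: power_one_over field_simps)
      finally show ?thesis by simp
    qed
  qed simp
  then have "limsup E \<in> null_sets (PiM UNIV noise_law)"
    by (intro borel_cantelli_limsup1 E(1)) (auto simp: less_top[symmetric])
  moreover have "\<xi> \<in> limsup E" if h: "h \<in> (\<Inter>m0. \<Union>m\<in>{m0..}. bad K b r m)" "\<forall>t\<in>K. h t = f t + noise r N \<xi> t" for \<xi> h
  proof -
    have "\<exists>k\<ge>n. \<xi> \<in> E k" for n
    proof -
      \<comment> \<open>\<open>E k\<close> belongs to level \<open>Suc k\<close>, whose estimate
        uses the preceding scale; hence the shift by one.\<close>
      obtain m where m: "m \<ge> Suc (max n k0)" "h \<in> bad K b r m" using h(1) by auto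
      obtain k where k: "m = Suc k" using m(1) by (cases m) auto
      then have "\<xi> \<in> E k" using E(3)[of k] m h(2) by auto
      then show ?thesis using m(1) k by auto
    qed
    then show ?thesis by (auto simp: limsup_INF_SUP)
  qed
  ultimately show ?thesis by blast
qed

text \<open>Such an \<open>f\<close> is bad at finitely many levels only, and from some
  \<open>m0\<close> on the negated conditions in \<open>bad\<close> are the hypotheses of
  \<open>fibers_of_regular\<close>, applied to the extension of \<open>f\<close> by 0.\<close>

lemma not_limsup_bad:
  fixes f :: "real \<Rightarrow> 'a::euclidean_space"
  assumes K: "compact K" and \<phi>: "gauge_function \<phi>"
    and b: "\<And>n. b n > 0" "b \<longlonglongrightarrow> 0"
    and r: "\<And>n. r n > 0" "(\<lambda>n. r n * cell_density TYPE('a) b n) \<longlonglongrightarrow> 0"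
    and r\<phi>: "\<And>n s. 0 < s \<Longrightarrow> s \<le> r n \<Longrightarrow> 6 * 2 ^ DIM('a) * cell_density TYPE('a) b (Suc n) * s \<le> \<phi> s"
    and f: "f \<in> carrier (C_group K)" "f \<notin> (\<Inter>m0. \<Union>m\<in>{m0..}. bad K b r m)"
  shows "\<exists>U. open U \<and> emeasure lebesgue (f -` U \<inter> K) = emeasure lebesgue K \<and>
           (\<forall>y\<in>U. hausdorff_measure \<phi> (f -` {y} \<inter> K) > 0)"
proof -
  define h where "h t = (if t \<in> K then f t else 0)" for t
  have f_cont: "continuous_on K f" using f(1) K by (simp add: carrier_C_group)
  have h_cont: "continuous_on K h" using f_cont by (auto simp: h_def cong: continuous_on_cong)
  have h_meas: "h \<in> borel_measurable borel"
    unfolding h_def[abs_def] by (rule borel_measurable_zero_extension[OF K f_cont])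
  have sm: "smoothed c T h y = smoothed c T f y" if "T \<subseteq> K" for c T y
    using that by (intro smoothed_cong) (auto simp: h_def)
  obtain m0 where m0: "\<And>m. m \<ge> m0 \<Longrightarrow> f \<notin> bad K b r m" using f(2) by auto
  have vim: "h -` V \<inter> K = f -` V \<inter> K" for V by (auto simp: h_def)
  show ?thesis
    unfolding vim[symmetric]
  proof (rule fibers_of_regular[OF K h_cont h_meas \<phi> b r r\<phi>])
    fix m y assume "m \<ge> m0"
    then show "\<bar>smoothed (b m) K h y - smoothed (b (Suc m)) K h y\<bar> \<le> (measure lborel K + 1) / 2 ^ m"
      using m0[of m] f(1) by (simp add: sm bad_def not_less)
  next
    fix m n j y assume "m \<ge> m0" "n < m"
    then show "\<bar>smoothed (b m) (K \<inter> cell (r n) j) h y - smoothed (b (Suc m)) (K \<inter> cell (r n) j) h y\<bar> \<le> r n / 2 ^ m"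
      using m0[of m] f(1) by (simp add: sm bad_def not_less) (meson not_le)
  qed
qed

theorem theorem8p2:
  fixes K :: "real set" and \<phi> :: "real \<Rightarrow> real"
  assumes "compact K"
    and "emeasure lebesgue K > 0"
    and "gauge_function \<phi>"
    and "filterlim (\<lambda>r. \<phi> r / r) at_top (at_right 0)"
  shows "prevalent (C_group K) (mtopology_of (C_metric K))
    {f \<in> carrier (C_group K) :: (real \<Rightarrow> real ^ 'd) set.
      \<exists>U. open U \<and> emeasure lebesgue (f -` U \<inter> K) = emeasure lebesgue K \<and>
          (\<forall>y\<in>U. hausdorff_measure \<phi> (f -` {y} \<inter> K) > 0)}"
proof -
  have K: "compact K" "K \<noteq> {}" using assms(1,2) by auto
  obtain A where A: "A > 0" "\<And>t. t \<in> K \<Longrightarrow> \<bar>t\<bar> \<le> A"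
    using compact_imp_bounded[OF K(1)] by (auto simp: bounded_pos)
  define b where "b = width TYPE(real ^ 'd)"
  have b: "b n > 0" "b n \<le> 1"
    "(b n + b (Suc n)) / tent_mass TYPE(real ^ 'd) (1 / 2 ^ n) \<le> 1 / 2 ^ Suc n" "b \<longlonglongrightarrow> 0" for n
    unfolding b_def by (rule width)+
  let ?mass = "tent_mass TYPE(real ^ 'd)" and ?D = "cell_density TYPE(real ^ 'd) b"
  have mass: "?mass (b n) > 0" for n using b(1) by (rule tent_mass_pos)
  have D: "?D n \<ge> 1" for n using mass[of "Suc n"] b(1)[of "Suc n"] by (simp add: cell_density_def)

  \<comment> \<open>Upper limits for the scales that do not depend on other scales. They collect the
    bound by 1, the decay of \<open>r n * ?D n\<close>, and the domination by \<open>\<phi>\<close>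
    of the linear function with the density of the next scale.\<close>
  have "\<forall>n. \<exists>\<rho>. \<rho> > 0 \<and> \<rho> \<le> 1 \<and> \<rho> * ?D n \<le> 1 / 2 ^ n \<and> (\<forall>s. 0 < s \<longrightarrow> s \<le> \<rho> \<longrightarrow> 6 * 2 ^ DIM(real ^ 'd) * ?D (Suc n) * s \<le> \<phi> s)"
  proof
    fix n
    obtain \<rho> where \<rho>: "\<rho> > 0" "\<forall>s. 0 < s \<longrightarrow> s \<le> \<rho> \<longrightarrow> 6 * 2 ^ DIM(real ^ 'd) * ?D (Suc n) * s \<le> \<phi> s"
      using gauge_dominates_linear[OF assms(4), of "6 * 2 ^ DIM(real ^ 'd) * ?D (Suc n)"] by blast
    define \<rho>' where "\<rho>' = min (min \<rho> 1) (1 / (2 ^ n * ?D n))"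
    have "\<rho>' * ?D n \<le> 1 / (2 ^ n * ?D n) * ?D n"
      using D[of n] by (intro mult_right_mono) (auto simp: \<rho>'_def)
    also have "\<dots> = 1 / 2 ^ n" using D[of n] by simp
    finally show "\<exists>\<rho>. \<rho> > 0 \<and> \<rho> \<le> 1 \<and> \<rho> * ?D n \<le> 1 / 2 ^ n \<and> (\<forall>s. 0 < s \<longrightarrow> s \<le> \<rho> \<longrightarrow> 6 * 2 ^ DIM(real ^ 'd) * ?D (Suc n) * s \<le> \<phi> s)"
      using \<rho> D[of n] by (intro exI[of _ \<rho>']) (auto simp: \<rho>'_def)
  qed
  from choice[OF this] obtain \<rho> where \<rho>: "\<And>n. \<rho> n > 0" "\<And>n. \<rho> n \<le> 1" "\<And>n. \<rho> n * ?D n \<le> 1 / 2 ^ n"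
    "\<And>n s. 0 < s \<Longrightarrow> s \<le> \<rho> n \<Longrightarrow> 6 * 2 ^ DIM(real ^ 'd) * ?D (Suc n) * s \<le> \<phi> s"
    by blast
  define L where "L = measure lborel K"
  define \<gamma> where "\<gamma> k = 1 / ?mass (b (Suc k)) + 1 / ?mass (b (Suc (Suc k)))" for k
  define \<beta> where "\<beta> k = b (Suc k) / ?mass (b (Suc k)) + b (Suc (Suc k)) / ?mass (b (Suc (Suc k)))" for k
  define \<delta> where "\<delta> k x = x / 2 ^ (k + 3)" for k :: nat and x :: real
  \<comment> \<open>The net radius: \<open>L * \<gamma> k\<close> is a Lipschitz constant in
    \<open>y\<close> for the difference of the two smoothed densities, so moving to the net costs at
    most \<open>\<delta>\<close>.\<close>
  define \<eta> where "\<eta> k x = \<delta> k x / (L * \<gamma> k + 1)" for k x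
  have "L \<ge> 0" by (simp add: L_def)
  have "\<gamma> k > 0" for k using mass[of "Suc k"] mass[of "Suc (Suc k)"] by (simp add: \<gamma>_def add_pos_pos)
  then have L\<gamma>: "L * \<gamma> k \<ge> 0" for k using \<open>L \<ge> 0\<close> by (simp add: less_imp_le)
  define Y where "Y k x = (SOME Y. finite Y \<and>
      (\<eta> k x > 0 \<longrightarrow> cball (0 :: real ^ 'd) (real k + 7) \<subseteq> (\<Union>y\<in>Y. ball y (\<eta> k x))))" for k x
  have "finite (Y k x) \<and> (\<eta> k x > 0 \<longrightarrow> cball 0 (real k + 7) \<subseteq> (\<Union>y\<in>Y k x. ball y (\<eta> k x)))" for k x
    unfolding Y_def by (rule someI_ex) (rule finite_net)
  then have Y: "finite (Y k x)"
    "\<eta> k x > 0 \<Longrightarrow> cball 0 (real k + 7) \<subseteq> (\<Union>y\<in>Y k x. ball y (\<eta> k x))" for k x by blast+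
  \<comment> \<open>The union bound at level \<open>Suc k\<close> without its factor
    \<open>r (Suc k)\<close>, as a function of the preceding scale \<open>x\<close>. For this reason
    \<open>\<delta>\<close>, \<open>\<eta>\<close> and \<open>Y\<close> are functions of
    \<open>x\<close> as well.\<close>
  define G where "G m x = (case m of 0 \<Rightarrow> 0 | Suc k \<Rightarrow>
      (1 + Suc k * card {- index_bound A x..index_bound A x}) * card (Y k x) * (12 * (2 * A + 5) * (\<beta> k)\<^sup>2 / (\<delta> k x)\<^sup>2))" for m x
  from exists_scales[where G = G, OF \<rho>(1)]
  obtain r where r_all: "\<forall>m. 0 < r m \<and> r m \<le> \<rho> m \<and> r (Suc m) \<le> r m \<and> r (Suc m) * G (Suc m) (r m) \<le> 1 / 2 ^ Suc m" ..
  have r: "0 < r m" "r m \<le> \<rho> m" "r (Suc m) \<le> r m" "r (Suc m) * G (Suc m) (r m) \<le> 1 / 2 ^ Suc m" for m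
    using spec[OF r_all, of m] by blast+
  have \<eta>: "\<eta> k (r k) > 0" for k using r(1)[of k] L\<gamma>[of k] by (simp add: \<eta>_def \<delta>_def add_nonneg_pos)
  have lip: "L * (\<eta> k (r k) / ?mass (b (Suc k)) + \<eta> k (r k) / ?mass (b (Suc (Suc k)))) \<le> \<delta> k (r k)" for k
  proof -
    have "L * (\<eta> k (r k) / ?mass (b (Suc k)) + \<eta> k (r k) / ?mass (b (Suc (Suc k)))) = (L * \<gamma> k) * \<eta> k (r k)"
      by (simp add: \<gamma>_def algebra_simps)
    also have "\<dots> \<le> (L * \<gamma> k + 1) * \<eta> k (r k)" using \<eta>[of k] by (intro mult_right_mono) auto
    also have "\<dots> = \<delta> k (r k)" using L\<gamma>[of k] by (simp add: \<eta>_def)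
    finally show ?thesis .
  qed
  have rD: "(\<lambda>n. r n * ?D n) \<longlonglongrightarrow> 0"
  proof (rule tendsto_sandwich[OF _ _ tendsto_const])
    show "(\<lambda>n. (1 / 2 :: real) ^ n) \<longlonglongrightarrow> 0" by (rule LIMSEQ_power_zero) simp
    have "r n * ?D n \<le> (1 / 2) ^ n" for n
    proof -
      have "r n * ?D n \<le> \<rho> n * ?D n" using r(2)[of n] D[of n] by (intro mult_right_mono) auto
      then show ?thesis using \<rho>(3)[of n] by (simp add: power_one_over)
    qed
    then show "\<forall>\<^sub>F n in sequentially. r n * ?D n \<le> (1 / 2) ^ n" by simp
    show "\<forall>\<^sub>F n in sequentially. 0 \<le> r n * ?D n"
      using r(1) D by (intro always_eventually allI mult_nonneg_nonneg) (auto intro: less_imp_le order_trans[of 0 1])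
  qed
  have r\<phi>: "6 * 2 ^ DIM(real ^ 'd) * ?D (Suc n) * s \<le> \<phi> s" if "0 < s" "s \<le> r n" for n s
    using \<rho>(4)[of s n] that r(2)[of n] by linarith

  define N where "N m = index_bound A (r m)" for m
  define X where "X = mtopology_of (C_metric K :: (real \<Rightarrow> real ^ 'd) metric)"
  \<comment> \<open>The limit superior of open sets, hence Borel; it is the Borel superset required
    by \<open>shy\<close>.\<close>
  define B where "B = (\<Inter>m0. \<Union>m\<in>{m0..}. bad K b r m :: (real \<Rightarrow> real ^ 'd) set)"
  have bad_sets: "bad K b r m \<in> sets (borel_algebra X)" for m
    unfolding X_def by (intro openin_borel_algebra openin_bad K(1) b(1))
  have B_sets: "B \<in> sets (borel_algebra X)"
    unfolding B_def using bad_sets by (intro sets.countable_INT image_subsetI sets.countable_UN) auto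
  let ?good = "{f \<in> carrier (C_group K) :: (real \<Rightarrow> real ^ 'd) set.
      \<exists>U. open U \<and> emeasure lebesgue (f -` U \<inter> K) = emeasure lebesgue K \<and>
          (\<forall>y\<in>U. hausdorff_measure \<phi> (f -` {y} \<inter> K) > 0)}"
  have sub: "carrier (C_group K) - ?good \<subseteq> B"
    using not_limsup_bad[OF K(1) assms(3) b(1,4) r(1) rD r\<phi>] unfolding B_def by blast

  interpret product_prob_space "noise_law :: _ \<Rightarrow> (real ^ 'd) measure" UNIV
    by (rule product_prob_space_noise_law)
  define S where "S \<xi> = (\<lambda>t\<in>K. noise r N \<xi> t)" for \<xi> :: "nat \<times> int \<Rightarrow> real ^ 'd"
  have S: "S \<in> measurable (PiM UNIV noise_law) (borel_algebra X)"
    unfolding S_def[abs_def] X_def by (rule measurable_noise_C[OF K r(1)])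
  define \<nu> where "\<nu> = distr (PiM UNIV noise_law) (borel_algebra X) S"
  have null: "emeasure \<nu> (B #>\<^bsub>C_group K\<^esub> x) = 0" if x: "x \<in> carrier (C_group K)" for x
  \<comment> \<open>Off \<open>sets \<nu>\<close> the value of \<open>emeasure\<close> is 0 by
    convention, so only the measurable case needs an argument.\<close>
  proof (cases "B #>\<^bsub>C_group K\<^esub> x \<in> sets \<nu>")
    case True
    \<comment> \<open>\<open>S \<xi>\<close> lies in the translate of \<open>B\<close> by
      \<open>x\<close> only if some \<open>h\<close> in \<open>B\<close> agrees on \<open>K\<close>
      with the noise minus \<open>x\<close>. So \<open>limsup_bad_null\<close> is used for
      \<open>- x\<close>, extended by 0.\<close>
    define f where "f t = (if t \<in> K then - x t else 0)" for t
    have x_cont: "continuous_on K x" using x K(1) by (simp add: carrier_C_group)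
    have f_meas: "f \<in> borel_measurable borel"
      unfolding f_def[abs_def] by (intro borel_measurable_zero_extension K(1) continuous_intros x_cont)
    obtain R where R: "norm (x t) \<le> R" if "t \<in> K" for t
      using compact_imp_bounded[OF compact_continuous_image[OF x_cont K(1)]] by (auto simp: bounded_iff)
    have f_bound: "norm (f t) \<le> R" if "t \<in> K" for t using R that by (simp add: f_def)
    obtain E where E: "E \<in> null_sets (PiM UNIV noise_law)"
      "{\<xi>. \<exists>h\<in>B. \<forall>t\<in>K. h t = f t + noise r N \<xi> t} \<subseteq> E"
      using limsup_bad_null[where Y = "\<lambda>k. Y k (r k)" and \<eta> = "\<lambda>k. \<eta> k (r k)", OF f_meas f_bound K(1) A(2,1) r(1,3) order_trans[OF r(2) \<rho>(2)] b(1-3)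
          Y(1) Y(2)[OF \<eta>] lip[unfolded L_def \<delta>_def] r(4)[unfolded G_def nat.case \<beta>_def \<delta>_def]]
      unfolding B_def N_def[abs_def] by blast
    have "S -` (B #>\<^bsub>C_group K\<^esub> x) \<subseteq> E"
    proof
      fix \<xi> assume "\<xi> \<in> S -` (B #>\<^bsub>C_group K\<^esub> x)"
      then obtain h where h: "h \<in> B" "S \<xi> = (\<lambda>t\<in>K. h t + x t)"
        by (auto simp: r_coset_def C_group_def)
      have "h t = f t + noise r N \<xi> t" if "t \<in> K" for t
        using fun_cong[OF h(2), of t] that by (simp add: S_def f_def)
      then show "\<xi> \<in> E" using E(2) h(1) by blast
    qed
    have "emeasure \<nu> (B #>\<^bsub>C_group K\<^esub> x) = emeasure (PiM UNIV noise_law) (S -` (B #>\<^bsub>C_group K\<^esub> x) \<inter> space (PiM UNIV noise_law))"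
      using True unfolding \<nu>_def by (intro emeasure_distr[OF S]) simp
    also have "\<dots> \<le> emeasure (PiM UNIV noise_law) E"
      using \<open>S -` (B #>\<^bsub>C_group K\<^esub> x) \<subseteq> E\<close> E(1) by (intro emeasure_mono) auto
    also have "\<dots> = 0" using E(1) by auto
    finally show ?thesis by simp
  qed (rule emeasure_notin_sets)
  have "prob_space \<nu>" unfolding \<nu>_def by (rule P.prob_space_distr[OF S])
  moreover have "sets \<nu> = sets (borel_algebra X)" by (simp add: \<nu>_def)
  ultimately have "shy (C_group K) X (carrier (C_group K) - ?good)"
    unfolding shy_def using sub B_sets null by blast
  then show ?thesis unfolding prevalent_def X_def by auto
qed

end
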